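(* Let $\varepsilon>0$ and $N\in\mathbb{N}$, $N\ge 1$. For $i=1,\dots,N$ let $\mathbb{X}_i\neq\emptyset$ be a compact Polish space, let $\mu_i\in\mathcal{M}^+(\mathbb{X}_i)$ be fully supported, let $\gamma_i\in\mathcal{M}^+(\mathbb{X}_i)$ be reference measures for $\mu=(\mu_1,\dots,\mu_N)$, i.e. $\mathrm{KL}(\mu^\otimes,\gamma^\otimes)<\infty$, and let $\varphi_i\in\Gamma_0(\mathbb{R})$ be an entropy function. Let $c\in C(\mathbb{X})$ be non-negative, where $\mathbb{X}=\mathbb{X}_1\times\dots\times\mathbb{X}_N$. Then the regularized unbalanced multi-marginal optimal transport problem $$\mathrm{UMOT}_\varepsilon(\mu)=\inf_{\pi\in\mathcal{M}^+(\mathbb{X})}\int_{\mathbb{X}}c\,\mathrm{d}\pi+\varepsilon\,\mathrm{KL}(\pi,\gamma^\otimes)+\sum_{i=1}^N D_{\varphi_i}\bigl((P_{\mathbb{X}_i})_\#\pi,\mu_i\bigr)$$ admits a unique optimal plan, i.e. there is a unique $\hat\pi\in\mathcal{M}^+(\mathbb{X})$ attaining the infimum.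
   Context: $\mathcal{M}^+(\mathbb{Y})$ denotes the finite non-negative Borel measures on a compact Polish space $\mathbb{Y}$. $\mu_i$ is fully supported if $\mathrm{supp}(\mu_i)=\mathbb{X}_i$. Write $\mu^\otimes=\bigotimes_{i=1}^N\mu_i$, $\gamma^\otimes=\bigotimes_{i=1}^N\gamma_i$. $P_{\mathbb{X}_i}:\mathbb{X}\to\mathbb{X}_i$ is the coordinate projection and $T_\#\pi=\pi\circ T^{-1}$ the push-forward, so $(P_{\mathbb{X}_i})_\#\pi$ is the $i$-th marginal of $\pi$. $\Gamma_0(\mathbb{R})$ is the set of proper, convex, lower semi-continuous functions $\mathbb{R}\to(-\infty,+\infty]$. An entropy function is a non-negative $\varphi\in\Gamma_0(\mathbb{R})$ with $\varphi(1)=0$ and $\varphi|_{(-\infty,0)}=\infty$; its recession constant is $\varphi'_\infty=\lim_{x\to\infty}\varphi(x)/x$. For $\mu,\nu\in\mathcal{M}^+(\mathbb{Y})$ with Lebesgue decomposition $\mu=\sigma_\mu\nu+\mu^\perp$ ($\mu^\perp\perp\nu$), the $\varphi$-divergence is $D_\varphi(\mu,\nu)=\int_{\mathbb{Y}}\varphi\circ\sigma_\mu\,\mathrm{d}\nu+\varphi'_\infty\,\mu^\perp(\mathbb{Y})\in[0,\infty]$ with $0\cdot\infty=0$. The Kullback–Leibler divergence is $\mathrm{KL}(\mu,\nu)=\int\ln\bigl(\tfrac{\mathrm{d}\mu}{\mathrm{d}\nu}\bigr)\mathrm{d}\mu+\nu(\mathbb{Y})-\mu(\mathbb{Y})$ if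 $\mu\ll\nu$ (with $0\ln 0=0$), and $+\infty$ otherwise.
   Formalization: The formal theorem additionally assumes that the infimum UMOT_ε(μ) is finite; otherwise (e.g. two one-point spaces with masses 1 and 2 and φ_i the indicator of {1}) every plan attains the value +∞ and uniqueness fails. *)

theory Defs
  imports "HOL-Analysis.Analysis"
begin

section \<open>Topological and measure-theoretic setting\<close>

text \<open>Spaces are abstract topologies, so that finitely many different spaces can be given as a
  family \<open>X :: nat \<Rightarrow> 'a topology\<close> over a common type without requiring their carriers to be
  types.\<close>

definition compact_polish_space :: "'a topology \<Rightarrow> bool" where
  "compact_polish_space X \<longleftrightarrow>
     compact_space X \<and> completely_metrizable_space X \<and> separable_space X"

definition borel_of :: "'a topology \<Rightarrow> 'a measure" where
  "borel_of X = sigma (topspace X) {U. openin X U}"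

definition finite_borel_measures :: "'a topology \<Rightarrow> 'a measure set" where
  "finite_borel_measures X = {\<mu>. sets \<mu> = sets (borel_of X) \<and> finite_measure \<mu>}"

definition support_of :: "'a topology \<Rightarrow> 'a measure \<Rightarrow> 'a set" where
  "support_of X \<mu> = {x \<in> topspace X. \<forall>U. openin X U \<and> x \<in> U \<longrightarrow> emeasure \<mu> U > 0}"

definition fully_supported :: "'a topology \<Rightarrow> 'a measure \<Rightarrow> bool" where
  "fully_supported X \<mu> \<longleftrightarrow> support_of X \<mu> = topspace X"


section \<open>Entropy functions\<close>

definition proper_fun :: "(real \<Rightarrow> ereal) \<Rightarrow> bool" where
  "proper_fun \<phi> \<longleftrightarrow> (\<forall>x. \<phi> x \<noteq> -\<infinity>) \<and> (\<exists>x. \<phi> x \<noteq> \<infinity>)"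

definition convex_fun :: "(real \<Rightarrow> ereal) \<Rightarrow> bool" where
  "convex_fun \<phi> \<longleftrightarrow>
     (\<forall>x y t. 0 < t \<and> t < 1 \<longrightarrow>
        \<phi> ((1 - t) * x + t * y) \<le> ereal (1 - t) * \<phi> x + ereal t * \<phi> y)"

definition lsc_fun :: "(real \<Rightarrow> ereal) \<Rightarrow> bool" where
  "lsc_fun \<phi> \<longleftrightarrow> (\<forall>x. \<phi> x \<le> Liminf (at x) \<phi>)"

definition Gamma0 :: "(real \<Rightarrow> ereal) set" where
  "Gamma0 = {\<phi>. proper_fun \<phi> \<and> convex_fun \<phi> \<and> lsc_fun \<phi>}"

definition entropy_function :: "(real \<Rightarrow> ereal) \<Rightarrow> bool" where
  "entropy_function \<phi> \<longleftrightarrow>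
     \<phi> \<in> Gamma0 \<and> (\<forall>x. 0 \<le> \<phi> x) \<and> \<phi> 1 = 0 \<and> (\<forall>x<0. \<phi> x = \<infinity>)"

definition recession_constant :: "(real \<Rightarrow> ereal) \<Rightarrow> ereal" where
  "recession_constant \<phi> = Lim at_top (\<lambda>x. \<phi> x / ereal x)"


section \<open>Divergences\<close>

definition mutually_singular :: "'a measure \<Rightarrow> 'a measure \<Rightarrow> bool" where
  "mutually_singular \<mu> \<nu> \<longleftrightarrow>
     (\<exists>A\<in>sets \<nu>. emeasure \<mu> A = 0 \<and> emeasure \<nu> (space \<nu> - A) = 0)"

definition lebesgue_decomposition ::
    "'a measure \<Rightarrow> 'a measure \<Rightarrow> ('a \<Rightarrow> real) \<Rightarrow> 'a measure \<Rightarrow> bool" where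
  "lebesgue_decomposition \<mu> \<nu> \<sigma> \<mu>s \<longleftrightarrow>
     \<sigma> \<in> borel_measurable \<nu> \<and> (\<forall>x. 0 \<le> \<sigma> x) \<and>
     sets \<mu>s = sets \<nu> \<and> mutually_singular \<mu>s \<nu> \<and>
     (\<forall>A\<in>sets \<nu>. emeasure \<mu> A = emeasure (density \<nu> (\<lambda>x. ennreal (\<sigma> x))) A + emeasure \<mu>s A)"

text \<open>For finite measures on the same sigma-algebra the decomposition exists, \<open>\<mu>s\<close> is unique and
  \<open>\<sigma>\<close> is unique \<open>\<nu>\<close>-almost everywhere, so the value below does not depend on the choice made by
  \<open>SOME\<close>. It is intended for non-negative \<open>\<phi>\<close>; in \<open>ennreal\<close>, \<open>0 * \<infinity> = 0\<close>.\<close>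

definition phi_divergence ::
    "(real \<Rightarrow> ereal) \<Rightarrow> 'a measure \<Rightarrow> 'a measure \<Rightarrow> ennreal" where
  "phi_divergence \<phi> \<mu> \<nu> =
     (let (\<sigma>, \<mu>s) = (SOME p. lebesgue_decomposition \<mu> \<nu> (fst p) (snd p))
      in (\<integral>\<^sup>+ x. e2ennreal (\<phi> (\<sigma> x)) \<partial>\<nu>) +
         e2ennreal (recession_constant \<phi>) * emeasure \<mu>s (space \<mu>s))"

text \<open>The integral of a real function in the extended sense: positive part minus negative part,
  either of which may be infinite (the Bochner integral would return 0 in that case).
  Note that \<open>ennreal\<close> maps negative reals to 0.\<close>

definition extended_integral :: "'a measure \<Rightarrow> ('a \<Rightarrow> real) \<Rightarrow> ereal" where
  "extended_integral M f =
     enn2ereal (\<integral>\<^sup>+ x. ennreal (f x) \<partial>M) - enn2ereal (\<integral>\<^sup>+ x. ennreal (- f x) \<partial>M)"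

text \<open>For finite measures the negative part of the logarithmic integral is always finite. The
  convention \<open>0 ln 0 = 0\<close> is not needed, because the density is positive \<open>\<mu>\<close>-almost everywhere.\<close>

definition KL :: "'a measure \<Rightarrow> 'a measure \<Rightarrow> ereal" where
  "KL \<mu> \<nu> =
     (if absolutely_continuous \<nu> \<mu>
      then extended_integral \<mu> (\<lambda>x. ln (enn2real (RN_deriv \<nu> \<mu> x)))
           + ereal (measure \<nu> (space \<nu>)) - ereal (measure \<mu> (space \<mu>))
      else \<infinity>)"


section \<open>Regularized unbalanced multi-marginal optimal transport\<close>

abbreviation prod_space :: "nat \<Rightarrow> (nat \<Rightarrow> 'a topology) \<Rightarrow> (nat \<Rightarrow> 'a) topology" where
  "prod_space N X \<equiv> product_topology X {1..N}"

text \<open>For second countable factors, the sigma-algebra of the product measure is the Borel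
  sigma-algebra of the product topology.\<close>

abbreviation prod_meas :: "nat \<Rightarrow> (nat \<Rightarrow> 'a measure) \<Rightarrow> (nat \<Rightarrow> 'a) measure" where
  "prod_meas N \<mu> \<equiv> PiM {1..N} \<mu>"

definition marginal :: "(nat \<Rightarrow> 'a topology) \<Rightarrow> (nat \<Rightarrow> 'a) measure \<Rightarrow> nat \<Rightarrow> 'a measure" where
  "marginal X \<pi> i = distr \<pi> (borel_of (X i)) (\<lambda>x. x i)"

definition UMOT_functional ::
    "real \<Rightarrow> nat \<Rightarrow> (nat \<Rightarrow> 'a topology) \<Rightarrow> ((nat \<Rightarrow> 'a) \<Rightarrow> real) \<Rightarrow> (nat \<Rightarrow> 'a measure) \<Rightarrow>
     (nat \<Rightarrow> real \<Rightarrow> ereal) \<Rightarrow> (nat \<Rightarrow> 'a measure) \<Rightarrow> (nat \<Rightarrow> 'a) measure \<Rightarrow> ereal" where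
  "UMOT_functional \<epsilon> N X c \<gamma> \<phi> \<mu> \<pi> =
     ereal (\<integral>x. c x \<partial>\<pi>) + ereal \<epsilon> * KL \<pi> (prod_meas N \<gamma>)
     + (\<Sum>i = 1..N. enn2ereal (phi_divergence (\<phi> i) (marginal X \<pi> i) (\<mu> i)))"

definition UMOT ::
    "real \<Rightarrow> nat \<Rightarrow> (nat \<Rightarrow> 'a topology) \<Rightarrow> ((nat \<Rightarrow> 'a) \<Rightarrow> real) \<Rightarrow> (nat \<Rightarrow> 'a measure) \<Rightarrow>
     (nat \<Rightarrow> real \<Rightarrow> ereal) \<Rightarrow> (nat \<Rightarrow> 'a measure) \<Rightarrow> ereal" where
  "UMOT \<epsilon> N X c \<gamma> \<phi> \<mu> =
     (INF \<pi>\<in>finite_borel_measures (prod_space N X). UMOT_functional \<epsilon> N X c \<gamma> \<phi> \<mu> \<pi>)"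

definition optimal_plan ::
    "real \<Rightarrow> nat \<Rightarrow> (nat \<Rightarrow> 'a topology) \<Rightarrow> ((nat \<Rightarrow> 'a) \<Rightarrow> real) \<Rightarrow> (nat \<Rightarrow> 'a measure) \<Rightarrow>
     (nat \<Rightarrow> real \<Rightarrow> ereal) \<Rightarrow> (nat \<Rightarrow> 'a measure) \<Rightarrow> (nat \<Rightarrow> 'a) measure \<Rightarrow> bool" where
  "optimal_plan \<epsilon> N X c \<gamma> \<phi> \<mu> \<pi> \<longleftrightarrow>
     \<pi> \<in> finite_borel_measures (prod_space N X) \<and>
     UMOT_functional \<epsilon> N X c \<gamma> \<phi> \<mu> \<pi> = UMOT \<epsilon> N X c \<gamma> \<phi> \<mu>"

end

theory Submission
  imports Defs
begin

text \<open>
  A plan of finite cost has finite Kullback--Leibler divergence from \<open>G = prod_meas N \<gamma>\<close>, so it has a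
  density \<open>f\<close> with respect to \<open>G\<close>. In terms of \<open>f\<close>, the divergence is the integral of
  \<open>h(f) = f ln f - f + 1 \<ge> 0\<close> (\<open>KL_density\<close>, \<open>KL_finite_imp_density\<close>), and the functional becomes
  \<open>J f + \<epsilon> \<integral> h(f) dG\<close>, where \<open>J\<close> collects the transport cost and the marginal penalties.

  The entropy is strictly convex in a quantitative way: the gap in midpoint convexity of \<open>h\<close> dominates
  a quarter of \<open>(sqrt a - sqrt b)\<^sup>2\<close> (\<open>kl_integrand_midpoint_gap\<close>). If \<open>J\<close> is convex, two densities whose
  energies are within \<open>\<eta>\<close> of the infimum have a midpoint of energy at least the infimum, so the
  integrated gap is at most \<open>\<eta> / \<epsilon>\<close> and the densities are close in \<open>L\<^sup>1\<close> (\<open>near_minimisers_close\<close>). This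
  yields uniqueness. It also makes minimising sequences Cauchy in \<open>L\<^sup>1\<close>, and along a fast one the
  densities converge almost everywhere, too. Existence is then the direct method with strong
  convergence (\<open>unique_minimiser\<close>): it asks only for lower semicontinuity of \<open>J\<close> along such sequences.

  The transport cost is linear in \<open>f\<close>, and Fatou's lemma applies to it. For the penalties, the \<open>i\<close>-th
  marginals of all plans with a density are dominated by the \<open>i\<close>-th marginal of \<open>G\<close>. Therefore one set
  \<open>A\<close> splits all of them into their absolutely continuous and singular parts with respect to \<open>\<mu> i\<close>,
  and \<open>D(\<nu>, \<mu> i) = \<integral> \<phi> i (d\<nu>|A / d\<mu> i) d(\<mu> i) + \<phi>'\<^sub>\<infinity> \<nu>(complement of A)\<close> holds with the same \<open>A\<close> for
  all marginals \<open>\<nu>\<close> (\<open>phi_divergence_separating_set\<close>, \<open>common_separating_set\<close>). Both terms are visibly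
  convex, and lower semicontinuous under convergence in total variation.

  The measures involved live on the same \<open>\<sigma>\<close>-algebra because the product of the Borel
  \<open>\<sigma>\<close>-algebras of finitely many second countable spaces is the Borel \<open>\<sigma>\<close>-algebra of the product
  (\<open>sets_PiM_borel_of\<close>).
\<close>

section \<open>The integrand of the relative entropy\<close>

definition kl_integrand :: "real \<Rightarrow> real" where
  "kl_integrand t = t * ln t - t + 1"

lemma kl_integrand_nonneg: "0 \<le> t \<Longrightarrow> 0 \<le> kl_integrand t"
proof (cases "t = 0")
  case False
  assume "0 \<le> t"
  with False have t: "0 < t" by simp
  have "ln (1 / t) \<le> 1 / t - 1" using t by (intro ln_le_minus_one) simp
  then have "t * (- ln t) \<le> t * (1 / t - 1)" using t by (intro mult_left_mono) (simp_all add: ln_div)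
  also have "\<dots> = 1 - t" using t by (simp add: field_simps)
  finally show ?thesis by (simp add: kl_integrand_def)
qed (simp add: kl_integrand_def)

text \<open>The linear bound is what turns an entropy bound into a mass bound. It is
  \<open>kl_integrand_nonneg\<close> at \<open>t / e\<close>, which gives the sharp constant \<open>e - 1 < 2\<close>.\<close>

lemma kl_integrand_linear_lower_bound:
  assumes "0 \<le> t"
  shows "t \<le> kl_integrand t + 2"
proof -
  have "0 \<le> exp 1 * kl_integrand (t / exp 1)"
    using assms by (intro mult_nonneg_nonneg kl_integrand_nonneg) auto
  also have "\<dots> = t * ln t - 2 * t + exp 1"
    by (cases "t = 0") (use assms in \<open>auto simp: kl_integrand_def ln_div field_simps\<close>)
  finally show ?thesis using exp_le by (simp add: kl_integrand_def)
qed

text \<open>The right-hand side is the Bregman divergence \<open>a ln (a / m) - a + m\<close>. Writing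
  \<open>a ln (a / m) = - 2 a ln (sqrt (m / a))\<close> and using \<open>ln u \<le> u - 1\<close> bounds it below by
  \<open>2 a - 2 sqrt (a m) - a + m\<close>, which is the left-hand side.\<close>

lemma bregman_ge_hellinger:
  assumes "0 \<le> a" "0 < m"
  shows "(sqrt a - sqrt m)\<^sup>2 \<le> kl_integrand a - kl_integrand m - ln m * (a - m)"
proof (cases "a = 0")
  case True
  then show ?thesis using assms by (simp add: kl_integrand_def algebra_simps)
next
  case False
  with assms have a: "0 < a" by simp
  have "ln (sqrt (m / a)) \<le> sqrt (m / a) - 1"
    using a assms by (intro ln_le_minus_one) simp
  then have "(ln m - ln a) / 2 \<le> sqrt (m / a) - 1"
    using a assms by (simp add: ln_sqrt ln_div)
  then have "2 * a * ((ln m - ln a) / 2) \<le> 2 * a * (sqrt (m / a) - 1)"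
    using a by (intro mult_left_mono) auto
  also have "\<dots> = 2 * (sqrt a * sqrt m) - 2 * a"
  proof -
    have "a * sqrt (m / a) = sqrt a * sqrt a * (sqrt m / sqrt a)"
      using a by (simp only: real_sqrt_divide real_sqrt_mult_self abs_of_pos)
    also have "\<dots> = sqrt a * sqrt m" using a by (simp del: real_sqrt_mult_self)
    finally show ?thesis by (simp add: algebra_simps)
  qed
  finally have "a * (ln m - ln a) \<le> 2 * (sqrt a * sqrt m) - 2 * a" by simp
  then show ?thesis using a assms
    by (simp add: kl_integrand_def power2_diff algebra_simps)
qed

text \<open>Quantitative strict convexity: averaging the Bregman bounds of \<open>a\<close> and \<open>b\<close> at their midpoint cancels
  the linear terms, and two Hellinger distances to the midpoint control the one between \<open>a\<close> and \<open>b\<close>.\<close>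

lemma kl_integrand_midpoint_gap:
  assumes "0 \<le> a" "0 \<le> b"
  shows "(sqrt a - sqrt b)\<^sup>2 / 4 \<le> (kl_integrand a + kl_integrand b) / 2 - kl_integrand ((a + b) / 2)"
proof (cases "a = 0 \<and> b = 0")
  case False
  define m where "m = (a + b) / 2"
  have m: "0 < m" using False assms by (auto simp: m_def)
  have "(sqrt a - sqrt b)\<^sup>2 \<le> 2 * ((sqrt a - sqrt m)\<^sup>2 + (sqrt b - sqrt m)\<^sup>2)"
  proof -
    have "(x - y)\<^sup>2 \<le> 2 * ((x - z)\<^sup>2 + (y - z)\<^sup>2)" for x y z :: real
      using zero_le_power2[of "(x - z) + (y - z)"] by (simp add: power2_eq_square algebra_simps)
    then show ?thesis .
  qed
  moreover have "ln m * (a - m) + ln m * (b - m) = ln m * (a + b - 2 * m)" by (simp add: algebra_simps)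
  then have "ln m * (a - m) + ln m * (b - m) = 0" by (simp add: m_def)
  moreover have "s / 4 \<le> (p + q) / 2 - r"
    if "s \<le> 2 * (x + y)" "v + w = 0" "x \<le> p - r - v" "y \<le> q - r - w" for s x y p q r v w :: real
    using that by argo
  ultimately show ?thesis
    using bregman_ge_hellinger[OF assms(1) m] bregman_ge_hellinger[OF assms(2) m]
    unfolding m_def[symmetric] by blast
qed (simp add: kl_integrand_def)

text \<open>Since \<open>\<bar>a - b\<bar> = \<bar>sqrt a - sqrt b\<bar> (sqrt a + sqrt b)\<close>, Young's inequality with weight \<open>\<delta>\<close> separates the
  convexity gap from the mass. Doing this pointwise replaces the Cauchy--Schwarz inequality that
  compares the Hellinger and \<open>L\<^sup>1\<close> distances of densities.\<close>

lemma kl_integrand_gap_L1: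
  assumes "0 \<le> a" "0 \<le> b" "0 < \<delta>"
  shows "\<bar>a - b\<bar> \<le> 2 / \<delta> * ((kl_integrand a + kl_integrand b) / 2 - kl_integrand ((a + b) / 2)) + \<delta> * (a + b)"
proof -
  define s t where "s = \<bar>sqrt a - sqrt b\<bar>" and "t = sqrt a + sqrt b"
  have "a - b = (sqrt a - sqrt b) * t"
    using assms by (simp add: t_def algebra_simps)
  then have eq: "\<bar>a - b\<bar> = s * t"
    using assms by (simp add: s_def t_def abs_mult)
  have "0 \<le> (s / \<delta> - t)\<^sup>2 * (\<delta> / 2)" using assms by simp
  also have "\<dots> = s\<^sup>2 / (2 * \<delta>) - s * t + \<delta> / 2 * t\<^sup>2"
    using assms by (simp add: power2_eq_square field_simps)
  finally have 1: "s * t \<le> s\<^sup>2 / (2 * \<delta>) + \<delta> / 2 * t\<^sup>2" by simp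
  have "t\<^sup>2 \<le> 2 * (a + b)"
    using zero_le_power2[of "sqrt a - sqrt b"] assms by (simp add: t_def power2_eq_square algebra_simps)
  then have "\<delta> / 2 * t\<^sup>2 \<le> \<delta> / 2 * (2 * (a + b))" using assms by (intro mult_left_mono) auto
  then have 2: "\<delta> / 2 * t\<^sup>2 \<le> \<delta> * (a + b)" by (simp add: distrib_left)
  have "s\<^sup>2 / 4 \<le> (kl_integrand a + kl_integrand b) / 2 - kl_integrand ((a + b) / 2)"
    using kl_integrand_midpoint_gap[OF assms(1,2)] by (simp add: s_def)
  then have "2 / \<delta> * (s\<^sup>2 / 4) \<le> 2 / \<delta> * ((kl_integrand a + kl_integrand b) / 2 - kl_integrand ((a + b) / 2))"
    using assms by (intro mult_left_mono) auto
  with 1 2 eq show ?thesis by (simp add: field_simps)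
qed

text \<open>Continuity up to the boundary point \<open>0\<close>, where \<open>ln 0 = 0\<close> makes \<open>t ln t\<close> vanish; there
  \<open>- t ln t \<le> 2 sqrt t\<close> is the required rate.\<close>

lemma tendsto_kl_integrand:
  assumes u: "u \<longlonglongrightarrow> t" "\<And>n. 0 \<le> u n"
  shows "(\<lambda>n. kl_integrand (u n)) \<longlonglongrightarrow> kl_integrand t"
proof (cases "t = 0")
  case True
  have b: "\<bar>s * ln s\<bar> \<le> s * s + 2 * sqrt s" if "0 \<le> s" for s :: real
  proof (cases "s = 0")
    case False
    with that have s: "0 < s" by simp
    have "ln s \<le> s" using ln_le_minus_one[OF s] by simp
    then have 1: "s * ln s \<le> s * s" using s by (intro mult_left_mono) auto
    have "ln (1 / sqrt s) \<le> 1 / sqrt s - 1" using s by (intro ln_le_minus_one) simp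
    then have "- ln s \<le> 2 / sqrt s" using s by (simp add: ln_div ln_sqrt)
    then have "s * (- ln s) \<le> s * (2 / sqrt s)" using s by (intro mult_left_mono) auto
    also have "\<dots> = 2 * sqrt s"
      using real_div_sqrt[of s] s by (simp add: mult.commute[of s])
    finally show ?thesis using 1 s by (simp add: abs_le_iff add_increasing add_increasing2)
  qed simp
  have "(\<lambda>n. u n * u n + 2 * sqrt (u n)) \<longlonglongrightarrow> t * t + 2 * sqrt t"
    by (intro tendsto_intros u)
  then have "(\<lambda>n. u n * u n + 2 * sqrt (u n)) \<longlonglongrightarrow> 0" using True by simp
  then have "(\<lambda>n. u n * ln (u n)) \<longlonglongrightarrow> 0"
    by (rule Lim_null_comparison[rotated]) (use b u in auto)
  from tendsto_add[OF tendsto_diff[OF this u(1)] tendsto_const[of 1]] show ?thesis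
    using True by (simp add: kl_integrand_def)
next
  case False
  show ?thesis unfolding kl_integrand_def
    by (intro tendsto_intros u False)
qed

lemma borel_measurable_kl_integrand[measurable]: "kl_integrand \<in> borel_measurable borel"
  unfolding kl_integrand_def by measurable

section \<open>Limits in \<open>ennreal\<close> and in \<open>L\<^sup>1\<close>\<close>

lemma ennreal_half_plus_half: "a / 2 + a / 2 = (a::ennreal)"
  by (cases a) (auto simp: divide_ennreal ennreal_top_divide simp flip: ennreal_numeral ennreal_plus)

lemma ennreal_midpoint:
  assumes "0 \<le> a" "0 \<le> b"
  shows "ennreal ((a + b) / 2) = ennreal a / 2 + ennreal b / 2"
  using assms by (simp add: add_divide_distrib divide_ennreal[symmetric])

text \<open>By monotone convergence the sum of the functions has a finite integral.\<close>

lemma AE_summable_of_nn_integral_geometric: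
  fixes w :: "nat \<Rightarrow> 'a \<Rightarrow> real"
  assumes [measurable]: "\<And>n. w n \<in> borel_measurable M"
    and "\<And>n x. 0 \<le> w n x"
    and C: "0 \<le> C" "\<And>n. (\<integral>\<^sup>+x. ennreal (w n x) \<partial>M) \<le> ennreal (C / 2 ^ n)"
  shows "AE x in M. summable (\<lambda>n. w n x)"
proof -
  have s: "summable (\<lambda>n. C / 2 ^ n)"
    using summable_mult[OF summable_geometric[of "1/2::real"], of C] by (simp add: power_divide)
  have "(\<integral>\<^sup>+x. (\<Sum>n. ennreal (w n x)) \<partial>M) = (\<Sum>n. \<integral>\<^sup>+x. ennreal (w n x) \<partial>M)"
    by (rule nn_integral_suminf) measurable
  also have "\<dots> \<le> (\<Sum>n. ennreal (C / 2 ^ n))"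
    by (intro suminf_le C) auto
  also have "\<dots> < \<infinity>"
    using s C by (subst suminf_ennreal2) auto
  finally have "(\<integral>\<^sup>+x. (\<Sum>n. ennreal (w n x)) \<partial>M) \<noteq> \<infinity>" by simp
  from nn_integral_PInf_AE[OF _ this] have "AE x in M. (\<Sum>n. ennreal (w n x)) \<noteq> \<infinity>" by simp
  then show ?thesis
    by eventually_elim (use assms(2) in \<open>simp add: summable_suminf_not_top\<close>)
qed

lemma AE_tendsto_of_L1_geometric:
  fixes u :: "nat \<Rightarrow> 'a \<Rightarrow> real"
  assumes [measurable]: "\<And>n. u n \<in> borel_measurable M" "v \<in> borel_measurable M"
    and "0 \<le> C" "\<And>n. (\<integral>\<^sup>+x. ennreal \<bar>u n x - v x\<bar> \<partial>M) \<le> ennreal (C / 2 ^ n)"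
  shows "AE x in M. (\<lambda>n. u n x) \<longlonglongrightarrow> v x"
proof -
  have "AE x in M. summable (\<lambda>n. \<bar>u n x - v x\<bar>)"
    using assms by (intro AE_summable_of_nn_integral_geometric[where C=C]) auto
  then show ?thesis
  proof eventually_elim
    case (elim x)
    from summable_LIMSEQ_zero[OF this] show ?case
      by (simp add: LIM_zero_iff tendsto_rabs_zero_iff)
  qed
qed

text \<open>The increments are summable almost everywhere, so the sequence converges pointwise, and Fatou's
  lemma turns the Cauchy estimate into an estimate of the distance to the limit. The absolute value in
  the choice of the limit makes it non-negative also on the exceptional null set.\<close>

lemma L1_geometric_Cauchy_limit:
  fixes f :: "nat \<Rightarrow> 'a \<Rightarrow> real"
  assumes int: "\<And>n. integrable M (f n)" and nn: "\<And>n x. 0 \<le> f n x" and C: "0 \<le> C"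
    and cau: "\<And>n m. n \<le> m \<Longrightarrow> (\<integral>\<^sup>+x. ennreal \<bar>f n x - f m x\<bar> \<partial>M) \<le> ennreal (C / 2 ^ n)"
  obtains g where "integrable M g" "\<And>x. 0 \<le> g x" "AE x in M. (\<lambda>n. f n x) \<longlonglongrightarrow> g x"
    "\<And>n. (\<integral>\<^sup>+x. ennreal \<bar>f n x - g x\<bar> \<partial>M) \<le> ennreal (C / 2 ^ n)"
proof
  have [measurable]: "\<And>n. f n \<in> borel_measurable M" using int by auto
  define g where "g x = \<bar>lim (\<lambda>n. f n x)\<bar>" for x
  show "\<And>x. 0 \<le> g x" by (simp add: g_def)
  have [measurable]: "g \<in> borel_measurable M" unfolding g_def by measurable
  have "AE x in M. summable (\<lambda>n. \<bar>f n x - f (Suc n) x\<bar>)"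
    using cau C by (intro AE_summable_of_nn_integral_geometric[where C=C]) auto
  then show lim: "AE x in M. (\<lambda>n. f n x) \<longlonglongrightarrow> g x"
  proof eventually_elim
    case (elim x)
    have "summable (\<lambda>n. \<bar>f (Suc n) x - f n x\<bar>)"
      using elim by (subst abs_minus_commute)
    then have "summable (\<lambda>n. f (Suc n) x - f n x)"
      by (rule summable_rabs_cancel)
    then have "convergent (\<lambda>n. \<Sum>i<n. f (Suc i) x - f i x)"
      by (simp add: summable_iff_convergent)
    then have "convergent (\<lambda>n. f n x)"
      using convergent_add[OF _ convergent_const[of "f 0 x"], of "\<lambda>n. \<Sum>i<n. f (Suc i) x - f i x"]
      unfolding sum_lessThan_telescope[of "\<lambda>n. f n x"] by simp
    then have L: "(\<lambda>n. f n x) \<longlonglongrightarrow> lim (\<lambda>n. f n x)" by (simp add: convergent_LIMSEQ_iff)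
    then have "0 \<le> lim (\<lambda>n. f n x)" using nn by (intro LIMSEQ_le_const) auto
    with L show ?case by (simp add: g_def)
  qed
  show bound: "(\<integral>\<^sup>+x. ennreal \<bar>f n x - g x\<bar> \<partial>M) \<le> ennreal (C / 2 ^ n)" for n
  proof -
    have "(\<integral>\<^sup>+x. ennreal \<bar>f n x - g x\<bar> \<partial>M) = (\<integral>\<^sup>+x. liminf (\<lambda>m. ennreal \<bar>f n x - f m x\<bar>) \<partial>M)"
      using lim
      by (intro nn_integral_cong_AE, eventually_elim)
         (auto intro!: lim_imp_Liminf[symmetric] tendsto_intros)
    also have "\<dots> \<le> liminf (\<lambda>m. \<integral>\<^sup>+x. ennreal \<bar>f n x - f m x\<bar> \<partial>M)"
      by (rule nn_integral_liminf) measurable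
    also have "\<dots> \<le> liminf (\<lambda>m. ennreal (C / 2 ^ n))"
      by (intro Liminf_mono eventually_sequentiallyI[of n] cau)
    also have "\<dots> = ennreal (C / 2 ^ n)" by (rule lim_imp_Liminf) auto
    finally show ?thesis .
  qed
  have "integrable M (\<lambda>x. f 0 x - g x)"
    using bound[of 0] by (intro integrableI_bounded) (auto simp: le_less_trans)
  from Bochner_Integration.integrable_diff[OF int[of 0] this] show "integrable M g" by simp
qed

text \<open>This is Fatou's lemma for the counting measure on two points.\<close>

lemma liminf_superadditive:
  fixes u v :: "nat \<Rightarrow> ennreal"
  shows "liminf u + liminf v \<le> liminf (\<lambda>n. u n + v n)"
proof -
  have "(\<integral>\<^sup>+b. liminf (\<lambda>n. if b then u n else v n) \<partial>count_space UNIV)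
     \<le> liminf (\<lambda>n. \<integral>\<^sup>+b. (if b then u n else v n) \<partial>count_space UNIV)"
    by (rule nn_integral_liminf) simp
  then show ?thesis by (simp add: nn_integral_count_space_finite UNIV_bool add.commute)
qed

lemma liminf_superadditive_sum:
  fixes u :: "'i \<Rightarrow> nat \<Rightarrow> ennreal"
  assumes "finite A"
  shows "(\<Sum>i\<in>A. liminf (u i)) \<le> liminf (\<lambda>n. \<Sum>i\<in>A. u i n)"
  using assms
proof (induction A)
  case (insert i A)
  then have "(\<Sum>i\<in>insert i A. liminf (u i)) \<le> liminf (u i) + liminf (\<lambda>n. \<Sum>i\<in>A. u i n)"
    by (simp add: add_left_mono)
  also have "\<dots> \<le> liminf (\<lambda>n. u i n + (\<Sum>i\<in>A. u i n))" by (rule liminf_superadditive)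
  finally show ?case using insert by simp
qed simp

text \<open>Fatou's lemma for a point mass of weight \<open>r\<close>; this covers \<open>r = \<infinity>\<close> together with the finite
  weights, which matters because a recession constant may be infinite.\<close>

lemma mult_liminf_le: "r * liminf u \<le> liminf (\<lambda>n. r * u n)" for r :: ennreal
proof -
  have "(\<integral>\<^sup>+b. liminf u \<partial>scale_measure r (count_space {()}))
     \<le> liminf (\<lambda>n. \<integral>\<^sup>+b. u n \<partial>scale_measure r (count_space {()}))"
    by (rule nn_integral_liminf) simp
  then show ?thesis by (simp add: nn_integral_count_space_finite space_scale_measure mult.commute)
qed

section \<open>Minimisation of entropically regularised functionals\<close>

text \<open>Densities are required to be non-negative and real everywhere, not just almost everywhere, so that
  they can be fed into \<open>kl_integrand\<close> without exceptional sets.\<close>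

definition densities :: "'a measure \<Rightarrow> ('a \<Rightarrow> real) set" where
  "densities M = {f. integrable M f \<and> (\<forall>x. 0 \<le> f x)}"

definition relative_entropy :: "'a measure \<Rightarrow> ('a \<Rightarrow> real) \<Rightarrow> ennreal" where
  "relative_entropy M f = (\<integral>\<^sup>+x. ennreal (kl_integrand (f x)) \<partial>M)"

lemma densitiesD:
  assumes "f \<in> densities M"
  shows "integrable M f" "f \<in> borel_measurable M" "0 \<le> f x"
  using assms by (auto simp: densities_def)

lemma midpoint_in_densities: "f \<in> densities M \<Longrightarrow> g \<in> densities M \<Longrightarrow> (\<lambda>x. (f x + g x) / 2) \<in> densities M"
  by (auto simp: densities_def)

lemma nn_integral_densities_finite: "f \<in> densities M \<Longrightarrow> (\<integral>\<^sup>+x. ennreal (f x) \<partial>M) < \<infinity>"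
  by (subst nn_integral_eq_integral) (auto simp: densities_def)

text \<open>Lower semicontinuity of \<open>J\<close> is only asked along sequences that converge both almost everywhere and
  geometrically fast in \<open>L\<^sup>1\<close>. This is the mode of convergence that suitably chosen minimising sequences
  have, and it lets each part of \<open>J\<close> be treated by Fatou's lemma without passing to subsequences.\<close>

locale entropic_functional = finite_measure G for G :: "'a measure" +
  fixes J :: "('a \<Rightarrow> real) \<Rightarrow> ennreal" and \<epsilon> :: real
  assumes eps: "0 < \<epsilon>"
  and J_convex: "\<And>f g. f \<in> densities G \<Longrightarrow> g \<in> densities G \<Longrightarrow>
      J (\<lambda>x. (f x + g x) / 2) \<le> J f / 2 + J g / 2"
  and J_lsc: "\<And>f g C. (\<And>n. f n \<in> densities G) \<Longrightarrow> g \<in> densities G \<Longrightarrow>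
      AE x in G. (\<lambda>n. f n x) \<longlonglongrightarrow> g x \<Longrightarrow> 0 \<le> C \<Longrightarrow>
      (\<And>n. (\<integral>\<^sup>+x. ennreal \<bar>f n x - g x\<bar> \<partial>G) \<le> ennreal (C / 2 ^ n)) \<Longrightarrow>
      J g \<le> liminf (\<lambda>n. J (f n))"
begin

definition energy :: "('a \<Rightarrow> real) \<Rightarrow> ennreal" where
  "energy f = J f + ennreal \<epsilon> * relative_entropy G f"

lemma mass_le_entropy:
  assumes "f \<in> densities G"
  shows "(\<integral>\<^sup>+x. ennreal (f x) \<partial>G) \<le> relative_entropy G f + ennreal (2 * measure G (space G))"
proof -
  note [measurable] = densitiesD(2)[OF assms]
  have "(\<integral>\<^sup>+x. ennreal (f x) \<partial>G) \<le> (\<integral>\<^sup>+x. ennreal (kl_integrand (f x)) + 2 \<partial>G)"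
  proof (rule nn_integral_mono)
    fix x
    have "ennreal (f x) \<le> ennreal (kl_integrand (f x) + 2)"
      using kl_integrand_linear_lower_bound densitiesD(3)[OF assms] by (intro ennreal_leI) auto
    also have "\<dots> = ennreal (kl_integrand (f x)) + 2"
      using kl_integrand_nonneg densitiesD(3)[OF assms] by (subst ennreal_plus) auto
    finally show "ennreal (f x) \<le> ennreal (kl_integrand (f x)) + 2" .
  qed
  also have "\<dots> = relative_entropy G f + ennreal (2 * measure G (space G))"
    by (subst nn_integral_add) (auto simp: relative_entropy_def emeasure_eq_measure ennreal_mult)
  finally show ?thesis .
qed

text \<open>The midpoint cannot have energy below \<open>I\<close>, while convexity of \<open>J\<close> makes it at most \<open>I + \<eta>\<close> minus
  \<open>\<epsilon>\<close> times the integrated convexity gap of the entropy. Hence that gap is at most \<open>\<eta> / \<epsilon>\<close>, and it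
  controls the \<open>L\<^sup>1\<close> distance. The case \<open>\<eta> = 0\<close> with \<open>\<delta>\<close> tending to \<open>0\<close> is uniqueness. Letting \<open>\<eta>\<close> tend
  to \<open>0\<close> faster than \<open>\<delta>\<close> gives the Cauchy property of minimising sequences of bounded mass.\<close>

lemma near_minimisers_close:
  assumes f: "f \<in> densities G" and g: "g \<in> densities G"
    and I: "I \<le> energy (\<lambda>x. (f x + g x) / 2)" "I < \<infinity>"
    and near: "energy f \<le> I + ennreal \<eta>" "energy g \<le> I + ennreal \<eta>"
    and "0 \<le> \<eta>" "0 < \<delta>"
  shows "(\<integral>\<^sup>+x. ennreal \<bar>f x - g x\<bar> \<partial>G) \<le> ennreal (2 / \<delta> * (\<eta> / \<epsilon>)) +
     ennreal \<delta> * ((\<integral>\<^sup>+x. ennreal (f x) \<partial>G) + (\<integral>\<^sup>+x. ennreal (g x) \<partial>G))"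
proof -
  note [measurable] = densitiesD(2)[OF f] densitiesD(2)[OF g]
  define m where "m x = (f x + g x) / 2" for x
  have m: "m \<in> densities G" using midpoint_in_densities[OF f g] by (simp add: m_def[abs_def])
  note [measurable] = densitiesD(2)[OF m]
  define gap where "gap x = (kl_integrand (f x) + kl_integrand (g x)) / 2 - kl_integrand (m x)" for x
  have [measurable]: "gap \<in> borel_measurable G" unfolding gap_def[abs_def] by measurable
  have gap0: "0 \<le> gap x" for x
    unfolding gap_def m_def
    by (rule order_trans[OF _ kl_integrand_midpoint_gap]) (use densitiesD(3)[OF f] densitiesD(3)[OF g] in auto)
  have ent: "relative_entropy G f / 2 + relative_entropy G g / 2 = relative_entropy G m + (\<integral>\<^sup>+x. ennreal (gap x) \<partial>G)"
  proof -
    have "relative_entropy G f / 2 + relative_entropy G g / 2 =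
       (\<integral>\<^sup>+x. ennreal (kl_integrand (f x)) / 2 + ennreal (kl_integrand (g x)) / 2 \<partial>G)"
      by (subst nn_integral_add) (auto simp: relative_entropy_def nn_integral_divide)
    also have "\<dots> = (\<integral>\<^sup>+x. ennreal (kl_integrand (m x)) + ennreal (gap x) \<partial>G)"
    proof (rule nn_integral_cong)
      fix x
      have n: "0 \<le> kl_integrand (f x)" "0 \<le> kl_integrand (g x)" "0 \<le> kl_integrand (m x)"
        using kl_integrand_nonneg densitiesD(3)[OF f] densitiesD(3)[OF g] densitiesD(3)[OF m] by auto
      have "ennreal (kl_integrand (f x)) / 2 + ennreal (kl_integrand (g x)) / 2 =
        ennreal (kl_integrand (f x) / 2 + kl_integrand (g x) / 2)"
        using n by (simp add: divide_ennreal[symmetric] flip: ennreal_numeral)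
      also have "kl_integrand (f x) / 2 + kl_integrand (g x) / 2 = kl_integrand (m x) + gap x"
        by (simp add: gap_def field_simps)
      finally show "ennreal (kl_integrand (f x)) / 2 + ennreal (kl_integrand (g x)) / 2 = ennreal (kl_integrand (m x)) + ennreal (gap x)"
        using n gap0[of x] by simp
    qed
    also have "\<dots> = relative_entropy G m + (\<integral>\<^sup>+x. ennreal (gap x) \<partial>G)"
      by (subst nn_integral_add) (auto simp: relative_entropy_def)
    finally show ?thesis .
  qed
  have "I + ennreal \<epsilon> * (\<integral>\<^sup>+x. ennreal (gap x) \<partial>G) \<le> energy m + ennreal \<epsilon> * (\<integral>\<^sup>+x. ennreal (gap x) \<partial>G)"
    using I by (intro add_right_mono) (simp add: m_def[abs_def])
  also have "\<dots> \<le> (J f / 2 + J g / 2) + ennreal \<epsilon> * (relative_entropy G f / 2 + relative_entropy G g / 2)"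
    unfolding ent energy_def using J_convex[OF f g]
    by (simp add: m_def[abs_def] distrib_left add.assoc add_right_mono)
  also have "\<dots> = energy f / 2 + energy g / 2"
    by (simp add: energy_def divide_ennreal_def algebra_simps)
  also have "\<dots> \<le> (I + ennreal \<eta>) / 2 + (I + ennreal \<eta>) / 2"
    using near by (intro add_mono divide_right_mono_ennreal)
  also have "\<dots> = I + ennreal \<eta>"
    by (rule ennreal_half_plus_half)
  finally have "ennreal \<epsilon> * (\<integral>\<^sup>+x. ennreal (gap x) \<partial>G) \<le> ennreal \<eta>"
    using I(2) by (auto simp: ennreal_add_left_cancel_le)
  then have "ennreal (1/\<epsilon>) * (ennreal \<epsilon> * (\<integral>\<^sup>+x. ennreal (gap x) \<partial>G)) \<le> ennreal (1/\<epsilon>) * ennreal \<eta>"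
    by (rule mult_left_mono) simp
  then have gap_le: "(\<integral>\<^sup>+x. ennreal (gap x) \<partial>G) \<le> ennreal (\<eta> / \<epsilon>)"
    using eps \<open>0 \<le> \<eta>\<close> by (simp add: mult.assoc[symmetric] flip: ennreal_mult)
  have "(\<integral>\<^sup>+x. ennreal \<bar>f x - g x\<bar> \<partial>G) \<le>
    (\<integral>\<^sup>+x. ennreal (2/\<delta>) * ennreal (gap x) + ennreal \<delta> * (ennreal (f x) + ennreal (g x)) \<partial>G)"
  proof (rule nn_integral_mono)
    fix x
    have "ennreal \<bar>f x - g x\<bar> \<le> ennreal (2 / \<delta> * gap x + \<delta> * (f x + g x))"
      using kl_integrand_gap_L1[of "f x" "g x" \<delta>] densitiesD(3)[OF f] densitiesD(3)[OF g] \<open>0 < \<delta>\<close>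
      by (intro ennreal_leI) (simp add: gap_def m_def)
    also have "\<dots> = ennreal (2/\<delta>) * ennreal (gap x) + ennreal \<delta> * (ennreal (f x) + ennreal (g x))"
      using gap0[of x] densitiesD(3)[OF f] densitiesD(3)[OF g] \<open>0 < \<delta>\<close>
      by (simp add: ennreal_mult[symmetric] ennreal_plus[symmetric] del: ennreal_plus)
    finally show "ennreal \<bar>f x - g x\<bar> \<le> \<dots>" .
  qed
  also have "\<dots> = ennreal (2/\<delta>) * (\<integral>\<^sup>+x. ennreal (gap x) \<partial>G) +
     ennreal \<delta> * ((\<integral>\<^sup>+x. ennreal (f x) \<partial>G) + (\<integral>\<^sup>+x. ennreal (g x) \<partial>G))"
    by (simp add: nn_integral_add nn_integral_cmult)
  also have "\<dots> \<le> ennreal (2/\<delta>) * ennreal (\<eta> / \<epsilon>) +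
     ennreal \<delta> * ((\<integral>\<^sup>+x. ennreal (f x) \<partial>G) + (\<integral>\<^sup>+x. ennreal (g x) \<partial>G))"
    by (intro add_right_mono mult_left_mono gap_le) simp
  also have "ennreal (2/\<delta>) * ennreal (\<eta> / \<epsilon>) = ennreal (2/\<delta> * (\<eta> / \<epsilon>))"
    using eps \<open>0 < \<delta>\<close> \<open>0 \<le> \<eta>\<close> by (subst ennreal_mult) auto
  finally show ?thesis .
qed

lemma entropy_lsc:
  assumes "\<And>n. f n \<in> densities G" "g \<in> densities G" "AE x in G. (\<lambda>n. f n x) \<longlonglongrightarrow> g x"
  shows "ennreal \<epsilon> * relative_entropy G g \<le> liminf (\<lambda>n. ennreal \<epsilon> * relative_entropy G (f n))"
proof -
  note [measurable] = densitiesD(2)[OF assms(1)] densitiesD(2)[OF assms(2)]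
  have "ennreal \<epsilon> * relative_entropy G g = (\<integral>\<^sup>+x. ennreal (\<epsilon> * kl_integrand (g x)) \<partial>G)"
    using eps kl_integrand_nonneg densitiesD(3)[OF assms(2)]
    by (simp add: relative_entropy_def ennreal_mult flip: nn_integral_cmult)
  also have "\<dots> = (\<integral>\<^sup>+x. liminf (\<lambda>n. ennreal (\<epsilon> * kl_integrand (f n x))) \<partial>G)"
    using assms(3)
    by (intro nn_integral_cong_AE, eventually_elim)
       (auto intro!: lim_imp_Liminf[symmetric] tendsto_intros tendsto_kl_integrand densitiesD(3)[OF assms(1)])
  also have "\<dots> \<le> liminf (\<lambda>n. \<integral>\<^sup>+x. ennreal (\<epsilon> * kl_integrand (f n x)) \<partial>G)"
    by (rule nn_integral_liminf) measurable
  also have "\<dots> = liminf (\<lambda>n. ennreal \<epsilon> * relative_entropy G (f n))"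
    using eps kl_integrand_nonneg densitiesD(3)[OF assms(1)]
    by (simp add: relative_entropy_def ennreal_mult flip: nn_integral_cmult)
  finally show ?thesis .
qed

text \<open>A minimising sequence with errors \<open>4\<^sup>-\<^sup>n\<close>, compared with \<open>\<delta> = 2\<^sup>-\<^sup>n\<close>, is Cauchy with rate
  \<open>2\<^sup>-\<^sup>n\<close>, because the masses are uniformly bounded by the energies. Its limit is a minimiser by lower
  semicontinuity.\<close>

theorem unique_minimiser:
  assumes f0: "f0 \<in> densities G" "energy f0 < \<infinity>"
  obtains f where "f \<in> densities G" "\<And>g. g \<in> densities G \<Longrightarrow> energy f \<le> energy g"
    "\<And>g. g \<in> densities G \<Longrightarrow> energy g \<le> energy f \<Longrightarrow> AE x in G. g x = f x"
proof -
  define I where "I = (INF f\<in> densities G. energy f)"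
  have I_le: "I \<le> energy f" if "f \<in> densities G" for f
    using that by (simp add: I_def INF_lower)
  have I_fin: "I < \<infinity>" using I_le[OF f0(1)] f0(2) by (rule le_less_trans)
  have "\<exists>f\<in> densities G. energy f < I + ennreal (1 / 4 ^ n)" for n :: nat
    using I_fin by (intro INF_approx_ennreal[OF _ I_def]) auto
  then obtain f where f: "\<And>n. f n \<in> densities G" and near: "\<And>n::nat. energy (f n) < I + ennreal (1 / 4 ^ n)"
    by metis
  note [measurable] = densitiesD(2)[OF f]
  \<comment> \<open>a bound for the mass of every density of energy at most \<open>I + 1\<close>\<close>
  define b where "b = ennreal (1 / \<epsilon>) * (I + 1) + ennreal (2 * measure G (space G))"
  have "b < \<infinity>" using I_fin by (auto simp: b_def ennreal_mult_less_top)
  then obtain B where B: "b = ennreal B" "0 \<le> B" by (cases b) auto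
  have mass: "(\<integral>\<^sup>+x. ennreal (f n x) \<partial>G) \<le> ennreal B" for n
  proof -
    have "ennreal \<epsilon> * relative_entropy G (f n) \<le> I + ennreal (1 / 4 ^ n)"
      using near[of n] by (metis add_increasing energy_def le_cases less_imp_le not_less order_trans zero_le)
    also have "\<dots> \<le> I + 1" by (intro add_left_mono) (simp add: ennreal_le_1 field_simps)
    finally have "ennreal (1 / \<epsilon>) * (ennreal \<epsilon> * relative_entropy G (f n)) \<le> ennreal (1 / \<epsilon>) * (I + 1)"
      by (rule mult_left_mono) simp
    then have "relative_entropy G (f n) \<le> ennreal (1 / \<epsilon>) * (I + 1)"
      using eps by (simp add: mult.assoc[symmetric] flip: ennreal_mult)
    then show ?thesis
      using mass_le_entropy[OF f[of n]] unfolding B(1)[symmetric] b_def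
      by (meson add_right_mono order_trans)
  qed
  define C where "C = 2 / \<epsilon> + 2 * B"
  have C: "0 \<le> C" using eps B by (simp add: C_def)
  have cau: "(\<integral>\<^sup>+x. ennreal \<bar>f n x - f m x\<bar> \<partial>G) \<le> ennreal (C / 2 ^ n)" if "n \<le> m" for n m
  proof -
    have "energy (f m) \<le> I + ennreal (1 / 4 ^ m)" using near by (rule less_imp_le)
    also have "\<dots> \<le> I + ennreal (1 / 4 ^ n)"
      using that by (intro add_left_mono ennreal_leI) (simp add: divide_simps power_increasing)
    finally have "(\<integral>\<^sup>+x. ennreal \<bar>f n x - f m x\<bar> \<partial>G) \<le> ennreal (2 / (1 / 2 ^ n) * (1 / 4 ^ n / \<epsilon>)) +
        ennreal (1 / 2 ^ n) * ((\<integral>\<^sup>+x. ennreal (f n x) \<partial>G) + (\<integral>\<^sup>+x. ennreal (f m x) \<partial>G))"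
      using near[of n] by (intro near_minimisers_close[OF f f I_le[OF midpoint_in_densities[OF f f]] I_fin]) auto
    also have "\<dots> \<le> ennreal (2 / (1 / 2 ^ n) * (1 / 4 ^ n / \<epsilon>)) + ennreal (1 / 2 ^ n) * (ennreal B + ennreal B)"
      by (intro add_left_mono mult_left_mono add_mono mass) simp
    also have "\<dots> = ennreal (2 / (1 / 2 ^ n) * (1 / 4 ^ n / \<epsilon>) + 1 / 2 ^ n * (B + B))"
    proof -
      have "ennreal (1 / 2 ^ n) * (ennreal B + ennreal B) = ennreal (1 / 2 ^ n * (B + B))"
        using B(2) by (simp only: ennreal_plus[symmetric]) (subst ennreal_mult, auto)
      then show ?thesis using eps B(2) by (subst ennreal_plus) auto
    qed
    also have "2 / (1 / 2 ^ n) * (1 / 4 ^ n / \<epsilon>) + 1 / 2 ^ n * (B + B) = C / 2 ^ n"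
    proof -
      have "(4::real) ^ n = 2 ^ n * 2 ^ n" by (simp flip: power_mult_distrib)
      then show ?thesis using eps by (simp add: C_def field_simps)
    qed
    finally show ?thesis .
  qed
  obtain g where g: "integrable G g" "\<And>x. 0 \<le> g x" "AE x in G. (\<lambda>n. f n x) \<longlonglongrightarrow> g x"
    "\<And>n. (\<integral>\<^sup>+x. ennreal \<bar>f n x - g x\<bar> \<partial>G) \<le> ennreal (C / 2 ^ n)"
    by (rule L1_geometric_Cauchy_limit[of G f C])
       (use densitiesD(1,3)[OF f] C cau in auto)
  have gd: "g \<in> densities G" using g by (simp add: densities_def)
  have "energy g \<le> liminf (\<lambda>n. J (f n)) + liminf (\<lambda>n. ennreal \<epsilon> * relative_entropy G (f n))"
    unfolding energy_def by (intro add_mono J_lsc[OF f gd g(3) C g(4)] entropy_lsc[OF f gd g(3)])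
  also have "\<dots> \<le> liminf (\<lambda>n. energy (f n))"
    unfolding energy_def by (rule liminf_superadditive)
  also have "\<dots> \<le> liminf (\<lambda>n. I + ennreal (1 / 4 ^ n))"
    by (intro Liminf_mono always_eventually allI less_imp_le near)
  also have "\<dots> = I"
  proof (rule lim_imp_Liminf)
    have "(\<lambda>n. (1/4::real) ^ n) \<longlonglongrightarrow> 0" by (rule LIMSEQ_power_zero) simp
    then have "(\<lambda>n. ennreal (1 / 4 ^ n)) \<longlonglongrightarrow> ennreal 0"
      by (intro tendsto_ennrealI) (simp add: power_one_over)
    from tendsto_add[OF tendsto_const[of I] this] show "(\<lambda>n. I + ennreal (1 / 4 ^ n)) \<longlonglongrightarrow> I" by simp
  qed simp
  finally have gI: "energy g \<le> I" .
  show ?thesis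
  proof (rule that[OF gd])
    show "energy g \<le> energy k" if "k \<in> densities G" for k
      using gI I_le[OF that] by (rule order_trans)
  next
    fix k assume k: "k \<in> densities G" "energy k \<le> energy g"
    note [measurable] = densitiesD(2)[OF k(1)] densitiesD(2)[OF gd]
    note fin = nn_integral_densities_finite
    obtain s where s: "(\<integral>\<^sup>+x. ennreal (k x) \<partial>G) + (\<integral>\<^sup>+x. ennreal (g x) \<partial>G) = ennreal s" "0 \<le> s"
      using fin[OF k(1)] fin[OF gd]
      by (cases "(\<integral>\<^sup>+x. ennreal (k x) \<partial>G) + (\<integral>\<^sup>+x. ennreal (g x) \<partial>G)") auto
    have "(\<integral>\<^sup>+x. ennreal \<bar>k x - g x\<bar> \<partial>G) \<le> 0"
    proof (rule ennreal_le_epsilon)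
      fix e :: real assume "0 < e"
      have "(\<integral>\<^sup>+x. ennreal \<bar>k x - g x\<bar> \<partial>G) \<le> ennreal (2 / (e / (s + 1)) * (0 / \<epsilon>)) + ennreal (e / (s + 1)) * ennreal s"
        unfolding s(1)[symmetric]
        using k(2) gI \<open>0 < e\<close> \<open>0 \<le> s\<close>
        by (intro near_minimisers_close[OF k(1) gd I_le[OF midpoint_in_densities[OF k(1) gd]] I_fin]) auto
      also have "\<dots> = ennreal (e / (s + 1) * s)" using s(2) \<open>0 < e\<close> by (simp flip: ennreal_mult)
      also have "\<dots> \<le> ennreal e" using s(2) \<open>0 < e\<close> by (intro ennreal_leI) (simp add: field_simps)
      finally show "(\<integral>\<^sup>+x. ennreal \<bar>k x - g x\<bar> \<partial>G) \<le> 0 + ennreal e" by simp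
    qed
    then show "AE x in G. k x = g x"
      by (simp add: nn_integral_0_iff_AE)
  qed
qed

end

section \<open>The Kullback--Leibler divergence as an integral functional\<close>

text \<open>With \<open>P\<close> and \<open>Q\<close> the integrals of the positive and negative parts of \<open>f ln f\<close>, the pointwise identity
  \<open>kl_integrand f + (f ln f)\<^sup>- + f = (f ln f)\<^sup>+ + 1\<close> between non-negative functions integrates without
  cancellation problems. As \<open>(f ln f)\<^sup>- \<le> 1\<close>, the integral \<open>Q\<close> is finite and can be moved to the other
  side, and so can the mass; \<open>P\<close> and the relative entropy are infinite together.\<close>

lemma KL_density:
  assumes "finite_measure G" and f: "f \<in> densities G"
  shows "KL (density G (\<lambda>x. ennreal (f x))) G = enn2ereal (relative_entropy G f)"
proof -
  interpret finite_measure G by fact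
  note [measurable] = densitiesD(2)[OF f] and nn = densitiesD(3)[OF f]
  define \<pi> where "\<pi> = density G (\<lambda>x. ennreal (f x))"
  have ac: "absolutely_continuous G \<pi>" unfolding \<pi>_def by (rule absolutely_continuousI_density) measurable
  have "AE x in G. ennreal (f x) = RN_deriv G \<pi> x"
    by (rule RN_deriv_unique) (simp_all add: \<pi>_def)
  then have "AE x in G. 0 < ennreal (f x) \<longrightarrow> ln (enn2real (RN_deriv G \<pi> x)) = ln (f x)"
    by eventually_elim (metis enn2real_ennreal nn)
  then have RN: "AE x in \<pi>. ln (enn2real (RN_deriv G \<pi> x)) = ln (f x)"
    unfolding \<pi>_def by (subst AE_density) auto
  define P where "P = (\<integral>\<^sup>+x. ennreal (f x * ln (f x)) \<partial>G)"
  define Q where "Q = (\<integral>\<^sup>+x. ennreal (- (f x * ln (f x))) \<partial>G)"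
  define m where "m = (\<integral>\<^sup>+x. ennreal (f x) \<partial>G)"
  have "extended_integral \<pi> (\<lambda>x. ln (enn2real (RN_deriv G \<pi> x))) =
    enn2ereal (\<integral>\<^sup>+x. ennreal (ln (f x)) \<partial>\<pi>) - enn2ereal (\<integral>\<^sup>+x. ennreal (- ln (f x)) \<partial>\<pi>)"
  proof -
    have "(\<integral>\<^sup>+x. ennreal (s * ln (enn2real (RN_deriv G \<pi> x))) \<partial>\<pi>) = (\<integral>\<^sup>+x. ennreal (s * ln (f x)) \<partial>\<pi>)" for s
      using RN by (intro nn_integral_cong_AE, eventually_elim) simp
    from this[of 1] this[of "-1"] show ?thesis unfolding extended_integral_def by simp
  qed
  also have "(\<integral>\<^sup>+x. ennreal (ln (f x)) \<partial>\<pi>) = P"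
    unfolding \<pi>_def P_def using nn by (subst nn_integral_density) (auto simp flip: ennreal_mult')
  also have "(\<integral>\<^sup>+x. ennreal (- ln (f x)) \<partial>\<pi>) = Q"
    unfolding \<pi>_def Q_def using nn by (subst nn_integral_density) (auto simp flip: ennreal_mult')
  finally have ext: "extended_integral \<pi> (\<lambda>x. ln (enn2real (RN_deriv G \<pi> x))) = enn2ereal P - enn2ereal Q" .
  have mfin: "m < \<infinity>" unfolding m_def by (rule nn_integral_densities_finite[OF f])
  have mass: "ereal (measure \<pi> (space \<pi>)) = enn2ereal m"
  proof -
    have "emeasure \<pi> (space \<pi>) = m" unfolding \<pi>_def m_def
      by (simp add: emeasure_density cong: nn_integral_cong)
    then show ?thesis using mfin by (cases m) (auto simp: measure_def)
  qed
  \<comment> \<open>\<open>- t ln t \<le> 1 - t\<close>, as \<open>kl_integrand\<close> is non-negative\<close>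
  have "Q \<le> (\<integral>\<^sup>+x. 1 \<partial>G)"
    unfolding Q_def
  proof (rule nn_integral_mono)
    fix x show "ennreal (- (f x * ln (f x))) \<le> 1"
      using kl_integrand_nonneg[OF nn, of x] nn[of x] by (simp add: kl_integrand_def ennreal_le_1)
  qed
  then have Qfin: "Q < \<infinity>" by (simp add: emeasure_eq_measure le_less_trans)
  have "relative_entropy G f + Q + m =
     (\<integral>\<^sup>+x. ennreal (kl_integrand (f x)) + ennreal (- (f x * ln (f x))) + ennreal (f x) \<partial>G)"
    unfolding relative_entropy_def Q_def m_def by (simp add: nn_integral_add)
  also have "\<dots> = (\<integral>\<^sup>+x. ennreal (f x * ln (f x)) + 1 \<partial>G)"
  proof (rule nn_integral_cong)
    fix x
    have e: "kl_integrand (f x) = f x * ln (f x) - f x + 1" by (simp add: kl_integrand_def)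
    have k: "0 \<le> kl_integrand (f x)" by (rule kl_integrand_nonneg[OF nn])
    show "ennreal (kl_integrand (f x)) + ennreal (- (f x * ln (f x))) + ennreal (f x) = ennreal (f x * ln (f x)) + 1"
    proof (cases "0 \<le> f x * ln (f x)")
      case True
      then have "ennreal (kl_integrand (f x)) + ennreal (- (f x * ln (f x))) + ennreal (f x) = ennreal (kl_integrand (f x) + f x)"
        using k nn[of x] by (simp add: ennreal_neg)
      also have "kl_integrand (f x) + f x = f x * ln (f x) + 1" using e by simp
      finally show ?thesis using True by simp
    next
      case False
      then have "ennreal (kl_integrand (f x)) + ennreal (- (f x * ln (f x))) + ennreal (f x)
         = ennreal (kl_integrand (f x) + - (f x * ln (f x)) + f x)"
        using k nn[of x] by (subst ennreal_plus) (auto simp del: ennreal_plus simp: ennreal_plus[symmetric])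
      also have "kl_integrand (f x) + - (f x * ln (f x)) + f x = 1" using e by simp
      finally show ?thesis using False by (simp add: ennreal_neg)
    qed
  qed
  also have "\<dots> = P + ennreal (measure G (space G))"
    unfolding P_def by (simp add: nn_integral_add emeasure_eq_measure)
  finally have id: "relative_entropy G f + Q + m = P + ennreal (measure G (space G))" .
  have "enn2ereal P - enn2ereal Q + ereal (measure G (space G)) - enn2ereal m = enn2ereal (relative_entropy G f)"
  proof (cases P)
    case (real p)
    then have "relative_entropy G f < \<infinity>" using id by (metis ennreal_add_eq_top ennreal_neq_top less_top infinity_ennreal_def)
    then show ?thesis using id real Qfin mfin
      by (cases Q; cases m; cases "relative_entropy G f") (auto simp flip: ennreal_plus)
  next
    case top
    then have "relative_entropy G f = top" using id Qfin mfin by (auto simp: ennreal_add_eq_top)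
    then show ?thesis using top Qfin mfin by (cases Q; cases m) auto
  qed
  then show ?thesis using ac by (simp add: KL_def ext mass flip: \<pi>_def)
qed

lemma KL_finite_imp_density:
  assumes "finite_measure G" "finite_measure \<pi>" and sets: "sets \<pi> = sets G" and "KL \<pi> G \<noteq> \<infinity>"
  obtains f where "f \<in> densities G" "\<pi> = density G (\<lambda>x. ennreal (f x))"
proof -
  interpret G: finite_measure G by fact
  interpret \<pi>: finite_measure \<pi> by fact
  have ac: "absolutely_continuous G \<pi>" using assms(4) by (auto simp: KL_def split: if_splits)
  from G.real_RN_deriv[OF assms(2) ac sets]
  obtain f where [measurable]: "f \<in> borel_measurable G" and RN: "AE x in G. RN_deriv G \<pi> x = ennreal (f x)"
    and nn: "\<And>x. 0 \<le> f x" by metis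
  have eq: "\<pi> = density G (\<lambda>x. ennreal (f x))"
    using G.density_RN_deriv[OF ac sets] density_cong[OF _ _ RN] by simp
  have "(\<integral>\<^sup>+x. ennreal (f x) \<partial>G) = emeasure \<pi> (space \<pi>)"
    by (subst (1 2) eq) (simp add: emeasure_density cong: nn_integral_cong)
  then have "integrable G f"
    using nn by (intro integrableI_nonneg) (auto simp: less_top[symmetric])
  then show ?thesis using that nn eq by (auto simp: densities_def)
qed

section \<open>Convexity and lower semicontinuity of divergences\<close>

lemma lsc_fun_eventually:
  assumes "lsc_fun \<phi>" "y < \<phi> t"
  shows "eventually (\<lambda>x. y < \<phi> x) (nhds t)"
proof -
  have "y < Liminf (at t) \<phi>" using assms by (auto simp: lsc_fun_def intro: less_le_trans)
  then have "eventually (\<lambda>x. y < \<phi> x) (at t)" by (rule less_LiminfD)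
  then show ?thesis
    unfolding eventually_at_filter by eventually_elim (metis UNIV_I assms(2))
qed

lemma borel_measurable_lsc_fun:
  assumes "lsc_fun \<phi>"
  shows "\<phi> \<in> borel_measurable borel"
proof (rule borel_measurableI_greater)
  fix y
  have "open {x. y < \<phi> x}"
    using lsc_fun_eventually[OF assms, of y] by (subst open_subopen) (fastforce simp: eventually_nhds subset_eq)
  then show "{x \<in> space borel. y < \<phi> x} \<in> sets borel"
    by simp
qed

text \<open>The divergence integrates \<open>\<phi>\<close> as a function into \<open>ennreal\<close>. For this version of \<open>\<phi>\<close>, convexity and
  lower semicontinuity carry over because \<open>\<phi>\<close> is non-negative.\<close>

locale nonneg_Gamma0 =
  fixes \<phi> :: "real \<Rightarrow> ereal"
  assumes Gamma0: "\<phi> \<in> Gamma0" and nonneg: "0 \<le> \<phi> x"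
begin

definition \<psi> :: "real \<Rightarrow> ennreal" where "\<psi> x = e2ennreal (\<phi> x)"

lemma less_psi_iff: "y < \<psi> x \<longleftrightarrow> enn2ereal y < \<phi> x"
  by (simp add: \<psi>_def less_ennreal.rep_eq enn2ereal_e2ennreal nonneg)

lemma borel_measurable_psi[measurable]: "\<psi> \<in> borel_measurable borel"
proof -
  have [measurable]: "\<phi> \<in> borel_measurable borel"
    using Gamma0 by (auto simp: Gamma0_def intro: borel_measurable_lsc_fun)
  show ?thesis unfolding \<psi>_def by measurable
qed

lemma psi_lsc_sequentially:
  assumes "u \<longlonglongrightarrow> t"
  shows "\<psi> t \<le> liminf (\<lambda>n. \<psi> (u n))"
  unfolding le_Liminf_iff
proof (intro allI impI)
  fix y assume "y < \<psi> t"
  then have "eventually (\<lambda>x. enn2ereal y < \<phi> x) (nhds t)"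
    using Gamma0 by (auto simp: less_psi_iff Gamma0_def intro: lsc_fun_eventually)
  then show "eventually (\<lambda>n. y < \<psi> (u n)) sequentially"
    using assms unfolding less_psi_iff filterlim_iff by blast
qed

lemma psi_midpoint: "\<psi> ((s + t) / 2) \<le> \<psi> s / 2 + \<psi> t / 2"
proof -
  have "\<phi> ((1 - 1/2) * s + 1/2 * t) \<le> ereal (1 - 1/2) * \<phi> s + ereal (1/2) * \<phi> t"
  proof -
    have "convex_fun \<phi>" using Gamma0 by (simp add: Gamma0_def)
    then have "0 < a \<and> a < 1 \<longrightarrow> \<phi> ((1 - a) * s + a * t) \<le> ereal (1 - a) * \<phi> s + ereal a * \<phi> t" for a
      unfolding convex_fun_def by blast
    from this[of "1/2"] show ?thesis by simp
  qed
  also have "\<dots> = enn2ereal (ennreal (1/2) * \<psi> s + ennreal (1/2) * \<psi> t)"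
    by (simp only: plus_ennreal.rep_eq times_ennreal.rep_eq \<psi>_def enn2ereal_e2ennreal[OF nonneg])
       (subst (1 2) enn2ereal_ennreal, simp_all)
  also have "(1 - 1/2) * s + 1/2 * t = (s + t) / 2" by (simp add: field_simps)
  finally have "\<psi> ((s + t) / 2) \<le> ennreal (1/2) * \<psi> s + ennreal (1/2) * \<psi> t"
    by (simp add: \<psi>_def less_eq_ennreal.rep_eq enn2ereal_e2ennreal nonneg)
  also have "ennreal (1/2) = inverse 2"
    by simp
  finally show ?thesis by (simp add: divide_ennreal_def mult.commute)
qed

end

text \<open>A set \<open>A\<close> that carries \<open>\<mu>\<close> and on which \<open>\<nu>\<close> is absolutely continuous with respect to \<open>\<mu>\<close>: cutting \<open>\<nu>\<close>
  along \<open>A\<close> is its Lebesgue decomposition. Unlike the decomposition itself, \<open>A\<close> can be shared by many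
  measures \<open>\<nu>\<close>.\<close>

definition separating_set :: "'a measure \<Rightarrow> 'a measure \<Rightarrow> 'a set \<Rightarrow> bool" where
  "separating_set \<nu> \<mu> A \<longleftrightarrow>
     A \<in> sets \<mu> \<and> emeasure \<mu> (space \<mu> - A) = 0 \<and>
     (\<forall>B\<in>sets \<mu>. B \<subseteq> A \<and> emeasure \<mu> B = 0 \<longrightarrow> emeasure \<nu> B = 0)"

text \<open>Remove a \<open>\<mu>\<close>-null set of largest possible \<open>\<nu>\<close>-measure: a further \<open>\<mu>\<close>-null set of positive
  \<open>\<nu>\<close>-measure would contradict maximality.\<close>

lemma separating_set_exists:
  assumes "finite_measure \<nu>" and sets: "sets \<nu> = sets \<mu>"
  obtains A where "separating_set \<nu> \<mu> A"
proof -
  interpret finite_measure \<nu> by fact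
  define s where "s = Sup (measure \<nu> ` null_sets \<mu>)"
  have bdd: "bdd_above (measure \<nu> ` null_sets \<mu>)"
    by (auto intro!: bdd_aboveI[where M="measure \<nu> (space \<nu>)"] bounded_measure)
  have le_s: "measure \<nu> N \<le> s" if "N \<in> null_sets \<mu>" for N
    unfolding s_def using that bdd by (intro cSup_upper) auto
  have "\<exists>N\<in>null_sets \<mu>. s - 1 / real (Suc n) < measure \<nu> N" for n
  proof -
    have "s - 1 / real (Suc n) < s" by simp
    then obtain y where "y \<in> measure \<nu> ` null_sets \<mu>" "s - 1 / real (Suc n) < y"
      unfolding s_def by (rule less_cSupE) blast
    then show ?thesis by auto
  qed
  then obtain N where N: "\<And>n. N n \<in> null_sets \<mu>" "\<And>n. s - 1 / real (Suc n) < measure \<nu> (N n)"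
    by metis
  define U where "U = (\<Union>n. N n)"
  have U: "U \<in> null_sets \<mu>" unfolding U_def using N(1) by auto
  have Us: "s \<le> measure \<nu> U"
  proof (rule field_le_epsilon)
    fix e :: real assume "0 < e"
    then obtain n where "1 / real (Suc n) < e" by (metis inverse_eq_divide reals_Archimedean)
    moreover have "measure \<nu> (N n) \<le> measure \<nu> U"
      unfolding U_def using N(1) sets by (intro finite_measure_mono) auto
    ultimately show "s \<le> measure \<nu> U + e" using N(2)[of n] by linarith
  qed
  have "separating_set \<nu> \<mu> (space \<mu> - U)"
    unfolding separating_set_def
  proof (intro conjI ballI impI)
    show "space \<mu> - U \<in> sets \<mu>" using U by auto
    have "space \<mu> - (space \<mu> - U) = U" using U sets.sets_into_space[of U \<mu>] by auto
    then show "emeasure \<mu> (space \<mu> - (space \<mu> - U)) = 0" using U by auto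
  next
    fix B assume B: "B \<in> sets \<mu>" "B \<subseteq> space \<mu> - U \<and> emeasure \<mu> B = 0"
    then have "measure \<nu> (U \<union> B) \<le> s" using U by (intro le_s) (auto intro: null_sets.Un)
    moreover have "measure \<nu> (U \<union> B) = measure \<nu> U + measure \<nu> B"
      using U B sets by (intro finite_measure_Union) auto
    ultimately have "measure \<nu> B = 0" using Us measure_nonneg[of \<nu> B] by linarith
    then show "emeasure \<nu> B = 0" by (simp add: emeasure_eq_measure)
  qed
  then show ?thesis by (rule that)
qed

text \<open>The reason for sharing: all measures dominated by \<open>\<kappa>\<close> are separated from \<open>\<mu>\<close> by one set.\<close>

lemma separating_set_absolutely_continuous:
  assumes "separating_set \<kappa> \<mu> A" "absolutely_continuous \<kappa> \<nu>" "sets \<kappa> = sets \<mu>"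
  shows "separating_set \<nu> \<mu> A"
  unfolding separating_set_def
proof (intro conjI ballI impI)
  fix B assume "B \<in> sets \<mu>" "B \<subseteq> A \<and> emeasure \<mu> B = 0"
  then have "B \<in> null_sets \<kappa>" using assms(1,3) by (auto simp: separating_set_def null_sets_def)
  then show "emeasure \<nu> B = 0" using assms(2) by (auto simp: absolutely_continuous_def)
qed (use assms(1) in \<open>auto simp: separating_set_def\<close>)

text \<open>Uniqueness of the Lebesgue decomposition, in the form that its two parts are the restrictions of \<open>\<nu>\<close>
  to \<open>A\<close> and to its complement. The singular part vanishes on \<open>A\<close>: it gives no mass to some set \<open>A'\<close>
  that carries \<open>\<mu>\<close>, and \<open>A - A'\<close> is null for \<open>\<mu>\<close>, hence for \<open>\<nu>\<close> and for the smaller singular part.\<close>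

lemma lebesgue_decomposition_parts:
  assumes A: "separating_set \<nu> \<mu> A" and dec: "lebesgue_decomposition \<nu> \<mu> \<sigma> \<mu>s"
    and B: "B \<in> sets \<mu>"
  shows "emeasure (density \<mu> (\<lambda>x. ennreal (\<sigma> x))) B = emeasure \<nu> (B \<inter> A)"
    and "emeasure \<mu>s B = emeasure \<nu> (B - A)"
proof -
  let ?D = "density \<mu> (\<lambda>x. ennreal (\<sigma> x))"
  have [measurable]: "A \<in> sets \<mu>" "\<sigma> \<in> borel_measurable \<mu>" "B \<in> sets \<mu>" and s: "sets \<mu>s = sets \<mu>"
    using A dec B by (auto simp: separating_set_def lebesgue_decomposition_def)
  have sum: "emeasure \<nu> E = emeasure ?D E + emeasure \<mu>s E" if "E \<in> sets \<mu>" for E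
    using dec that by (simp add: lebesgue_decomposition_def)
  obtain A' where A'[measurable]: "A' \<in> sets \<mu>" "emeasure \<mu>s A' = 0" "emeasure \<mu> (space \<mu> - A') = 0"
    using dec by (auto simp: lebesgue_decomposition_def mutually_singular_def)
  have Bsp: "B \<subseteq> space \<mu>" using B by (rule sets.sets_into_space)
  have D0: "emeasure ?D E = 0" if "E \<in> sets \<mu>" "emeasure \<mu> E = 0" for E
    using absolutely_continuousI_density[of "\<lambda>x. ennreal (\<sigma> x)" \<mu>] that
    by (auto simp: absolutely_continuous_def null_sets_def)
  have "emeasure \<mu> (B \<inter> A - A') \<le> emeasure \<mu> (space \<mu> - A')"
    using Bsp by (intro emeasure_mono) auto
  then have "emeasure \<mu> (B \<inter> A - A') = 0" using A' by simp
  then have "emeasure \<nu> (B \<inter> A - A') = 0"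
    using A unfolding separating_set_def by (auto dest!: bspec[of _ _ "B \<inter> A - A'"])
  then have "emeasure \<mu>s (B \<inter> A - A') = 0" using sum[of "B \<inter> A - A'"] by simp
  moreover have "emeasure \<mu>s (B \<inter> A \<inter> A') \<le> emeasure \<mu>s A'"
    using s by (intro emeasure_mono) auto
  ultimately have sing: "emeasure \<mu>s (B \<inter> A) = 0"
    using A'(2) plus_emeasure[of "B \<inter> A \<inter> A'" \<mu>s "B \<inter> A - A'"] s
    by (auto simp: Int_Diff_Un Diff_Int_distrib Int_Diff_disjoint)
  have "emeasure \<mu> (B - A) \<le> emeasure \<mu> (space \<mu> - A)"
    using Bsp by (intro emeasure_mono) auto
  then have "emeasure \<mu> (B - A) = 0" using A by (simp add: separating_set_def)
  then have ac: "emeasure ?D (B - A) = 0" by (intro D0) auto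
  have split: "emeasure M B = emeasure M (B \<inter> A) + emeasure M (B - A)" if "sets M = sets \<mu>" for M
    using that plus_emeasure[of "B \<inter> A" M "B - A"] by (simp add: Int_Diff_Un Int_Diff_disjoint)
  show "emeasure ?D B = emeasure \<nu> (B \<inter> A)"
    using split[of ?D] ac sum[of "B \<inter> A"] sing by simp
  show "emeasure \<mu>s B = emeasure \<nu> (B - A)"
    using split[OF s] ac sum[of "B - A"] sing by simp
qed

lemma emeasure_density_indicator:
  assumes "E \<in> sets M" "B \<in> sets M"
  shows "emeasure (density M (indicator E)) B = emeasure M (E \<inter> B)"
  using assms by (subst emeasure_density) (auto simp: indicator_inter_arith[symmetric])

lemma lebesgue_decomposition_exists:
  assumes fin: "finite_measure \<nu>" "finite_measure \<mu>" and sets: "sets \<nu> = sets \<mu>"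
    and A: "separating_set \<nu> \<mu> A"
  shows "\<exists>\<sigma> \<mu>s. lebesgue_decomposition \<nu> \<mu> \<sigma> \<mu>s"
proof -
  interpret \<nu>: finite_measure \<nu> by fact
  interpret \<mu>: finite_measure \<mu> by fact
  have sp: "space \<nu> = space \<mu>" using sets by (rule sets_eq_imp_space_eq)
  have [measurable]: "A \<in> sets \<mu>" and [measurable]: "A \<in> sets \<nu>" using A sets by (auto simp: separating_set_def)
  define \<nu>a where "\<nu>a = density \<nu> (indicator A)"
  define \<nu>s where "\<nu>s = density \<nu> (indicator (space \<nu> - A))"
  have sets_a: "sets \<nu>a = sets \<mu>" and sets_s: "sets \<nu>s = sets \<mu>" using sets by (auto simp: \<nu>a_def \<nu>s_def)
  have ea: "emeasure \<nu>a B = emeasure \<nu> (A \<inter> B)" if "B \<in> sets \<mu>" for B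
    unfolding \<nu>a_def by (rule emeasure_density_indicator) (use that sets in auto)
  have es: "emeasure \<nu>s B = emeasure \<nu> ((space \<nu> - A) \<inter> B)" if "B \<in> sets \<mu>" for B
    unfolding \<nu>s_def
  proof (rule emeasure_density_indicator)
    show "space \<nu> - A \<in> sets \<nu>" by (rule sets.compl_sets) fact
    show "B \<in> sets \<nu>" using that sets by simp
  qed
  interpret a: finite_measure \<nu>a
    by (rule finite_measureI) (use sets_eq_imp_space_eq[OF sets_a] in \<open>simp add: ea \<nu>.emeasure_finite\<close>)
  have "absolutely_continuous \<mu> \<nu>a"
    unfolding absolutely_continuous_def
  proof
    fix B assume B: "B \<in> null_sets \<mu>"
    then have "emeasure \<mu> (A \<inter> B) = 0" by (intro null_setsD1 null_set_Int1) auto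
    then have "emeasure \<nu> (A \<inter> B) = 0" using A B by (auto simp: separating_set_def)
    then show "B \<in> null_sets \<nu>a" using B sets_a ea[of B] by (auto simp: null_sets_def)
  qed
  from \<mu>.real_RN_deriv[OF a.finite_measure_axioms this sets_a]
  obtain \<sigma> where \<sigma>[measurable]: "\<sigma> \<in> borel_measurable \<mu>" and RN: "AE x in \<mu>. RN_deriv \<mu> \<nu>a x = ennreal (\<sigma> x)"
    and nn: "\<And>x. 0 \<le> \<sigma> x" by metis
  have "density \<mu> (\<lambda>x. ennreal (\<sigma> x)) = density \<mu> (RN_deriv \<mu> \<nu>a)"
    using RN by (intro density_cong) auto
  also have "\<dots> = \<nu>a"
    by (rule \<mu>.density_RN_deriv) fact+
  finally have d: "density \<mu> (\<lambda>x. ennreal (\<sigma> x)) = \<nu>a" .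
  have "lebesgue_decomposition \<nu> \<mu> \<sigma> \<nu>s"
    unfolding lebesgue_decomposition_def d mutually_singular_def
  proof (intro conjI ballI allI bexI[of _ A])
    fix B assume B: "B \<in> sets \<mu>"
    then have "emeasure \<nu> B = emeasure \<nu> ((A \<inter> B) \<union> ((space \<nu> - A) \<inter> B))"
      using sets.sets_into_space[of B \<mu>] sp by (intro arg_cong[where f="emeasure \<nu>"]) auto
    also have "\<dots> = emeasure \<nu>a B + emeasure \<nu>s B"
      unfolding ea[OF B] es[OF B]
    proof (rule plus_emeasure[symmetric])
      have [measurable]: "B \<in> sets \<nu>" using B sets by simp
      show "A \<inter> B \<in> sets \<nu>" "(space \<nu> - A) \<inter> B \<in> sets \<nu>" by measurable
    qed blast
    finally show "emeasure \<nu> B = emeasure \<nu>a B + emeasure \<nu>s B" .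
  next
    have "(space \<nu> - A) \<inter> A = {}" by auto
    then show "emeasure \<nu>s A = 0" by (simp add: es)
  qed (use nn sets_s A in \<open>auto simp: separating_set_def\<close>)
  then show ?thesis by blast
qed

text \<open>The divergence is defined through an arbitrarily chosen Lebesgue decomposition; a separating set
  makes the value explicit.\<close>

lemma (in nonneg_Gamma0) phi_divergence_separating_set:
  assumes fin: "finite_measure \<nu>" "finite_measure \<mu>" and sets: "sets \<nu> = sets \<mu>"
    and A: "separating_set \<nu> \<mu> A"
  obtains \<sigma> where "\<sigma> \<in> borel_measurable \<mu>" "\<And>x. 0 \<le> \<sigma> x"
    "\<And>B. B \<in> sets \<mu> \<Longrightarrow> emeasure (density \<mu> (\<lambda>x. ennreal (\<sigma> x))) B = emeasure \<nu> (B \<inter> A)"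
    "phi_divergence \<phi> \<nu> \<mu> = (\<integral>\<^sup>+x. \<psi> (\<sigma> x) \<partial>\<mu>)
       + e2ennreal (recession_constant \<phi>) * emeasure \<nu> (space \<mu> - A)"
proof -
  define p where "p = (SOME p. lebesgue_decomposition \<nu> \<mu> (fst p) (snd p))"
  obtain \<sigma> \<mu>s where p: "p = (\<sigma>, \<mu>s)" by fastforce
  have "\<exists>p. lebesgue_decomposition \<nu> \<mu> (fst p) (snd p)"
    using lebesgue_decomposition_exists[OF assms] by auto
  from someI_ex[OF this] have dec: "lebesgue_decomposition \<nu> \<mu> \<sigma> \<mu>s"
    by (simp add: p_def[symmetric] p)
  then have "space \<mu>s = space \<mu>"
    by (auto simp: lebesgue_decomposition_def dest: sets_eq_imp_space_eq)
  then have "phi_divergence \<phi> \<nu> \<mu> = (\<integral>\<^sup>+x. \<psi> (\<sigma> x) \<partial>\<mu>)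
       + e2ennreal (recession_constant \<phi>) * emeasure \<nu> (space \<mu> - A)"
    using lebesgue_decomposition_parts(2)[OF A dec, of "space \<mu>"]
    by (simp add: phi_divergence_def \<psi>_def p_def[symmetric] p)
  then show ?thesis
    using dec lebesgue_decomposition_parts(1)[OF A dec] by (intro that[of \<sigma>]) (auto simp: lebesgue_decomposition_def)
qed

text \<open>With a common separating set both terms of the divergence are convex: the densities average almost
  everywhere because the measures do, and the singular term is linear.\<close>

lemma (in nonneg_Gamma0) phi_divergence_midpoint:
  assumes fin: "finite_measure \<mu>" "finite_measure \<nu>" "finite_measure \<nu>1" "finite_measure \<nu>2"
    and sets: "sets \<nu> = sets \<mu>" "sets \<nu>1 = sets \<mu>" "sets \<nu>2 = sets \<mu>"
    and A: "separating_set \<nu> \<mu> A" "separating_set \<nu>1 \<mu> A" "separating_set \<nu>2 \<mu> A"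
    and mid: "\<And>B. B \<in> sets \<mu> \<Longrightarrow> emeasure \<nu> B = emeasure \<nu>1 B / 2 + emeasure \<nu>2 B / 2"
  shows "phi_divergence \<phi> \<nu> \<mu> \<le> phi_divergence \<phi> \<nu>1 \<mu> / 2 + phi_divergence \<phi> \<nu>2 \<mu> / 2"
proof -
  interpret \<mu>: finite_measure \<mu> by fact
  let ?r = "e2ennreal (recession_constant \<phi>)"
  have [measurable]: "A \<in> sets \<mu>" using A by (simp add: separating_set_def)
  obtain \<sigma> where \<sigma>[measurable]: "\<sigma> \<in> borel_measurable \<mu>" and s0: "\<And>x. 0 \<le> \<sigma> x"
    and s: "\<And>B. B \<in> sets \<mu> \<Longrightarrow> emeasure (density \<mu> (\<lambda>x. ennreal (\<sigma> x))) B = emeasure \<nu> (B \<inter> A)"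
    and D: "phi_divergence \<phi> \<nu> \<mu> = (\<integral>\<^sup>+x. \<psi> (\<sigma> x) \<partial>\<mu>) + ?r * emeasure \<nu> (space \<mu> - A)"
    by (rule phi_divergence_separating_set[OF fin(2,1) sets(1) A(1)]) blast
  obtain \<sigma>1 where \<sigma>1[measurable]: "\<sigma>1 \<in> borel_measurable \<mu>" and s10: "\<And>x. 0 \<le> \<sigma>1 x"
    and s1: "\<And>B. B \<in> sets \<mu> \<Longrightarrow> emeasure (density \<mu> (\<lambda>x. ennreal (\<sigma>1 x))) B = emeasure \<nu>1 (B \<inter> A)"
    and D1: "phi_divergence \<phi> \<nu>1 \<mu> = (\<integral>\<^sup>+x. \<psi> (\<sigma>1 x) \<partial>\<mu>) + ?r * emeasure \<nu>1 (space \<mu> - A)"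
    by (rule phi_divergence_separating_set[OF fin(3,1) sets(2) A(2)]) blast
  obtain \<sigma>2 where \<sigma>2[measurable]: "\<sigma>2 \<in> borel_measurable \<mu>" and s20: "\<And>x. 0 \<le> \<sigma>2 x"
    and s2: "\<And>B. B \<in> sets \<mu> \<Longrightarrow> emeasure (density \<mu> (\<lambda>x. ennreal (\<sigma>2 x))) B = emeasure \<nu>2 (B \<inter> A)"
    and D2: "phi_divergence \<phi> \<nu>2 \<mu> = (\<integral>\<^sup>+x. \<psi> (\<sigma>2 x) \<partial>\<mu>) + ?r * emeasure \<nu>2 (space \<mu> - A)"
    by (rule phi_divergence_separating_set[OF fin(4,1) sets(3) A(3)]) blast
  have "density \<mu> (\<lambda>x. ennreal (\<sigma> x)) = density \<mu> (\<lambda>x. ennreal ((\<sigma>1 x + \<sigma>2 x) / 2))"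
  proof (rule measure_eqI)
    fix B assume "B \<in> sets (density \<mu> (\<lambda>x. ennreal (\<sigma> x)))"
    then have [measurable]: "B \<in> sets \<mu>" by simp
    have "emeasure (density \<mu> (\<lambda>x. ennreal (\<sigma> x))) B =
       emeasure (density \<mu> (\<lambda>x. ennreal (\<sigma>1 x))) B / 2 + emeasure (density \<mu> (\<lambda>x. ennreal (\<sigma>2 x))) B / 2"
      by (simp add: s s1 s2 mid)
    also have "\<dots> = (\<integral>\<^sup>+x. ennreal (\<sigma>1 x) * indicator B x / 2 + ennreal (\<sigma>2 x) * indicator B x / 2 \<partial>\<mu>)"
      by (simp add: emeasure_density nn_integral_add nn_integral_divide)
    also have "\<dots> = emeasure (density \<mu> (\<lambda>x. ennreal ((\<sigma>1 x + \<sigma>2 x) / 2))) B"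
      unfolding ennreal_midpoint[OF s10 s20]
      by (subst emeasure_density) (auto intro!: nn_integral_cong split: split_indicator)
    finally show "emeasure (density \<mu> (\<lambda>x. ennreal (\<sigma> x))) B = \<dots>" .
  qed simp
  then have "AE x in \<mu>. ennreal (\<sigma> x) = ennreal ((\<sigma>1 x + \<sigma>2 x) / 2)"
    by (intro \<mu>.density_unique) auto
  then have eq: "AE x in \<mu>. \<sigma> x = (\<sigma>1 x + \<sigma>2 x) / 2"
    by eventually_elim (use s0 s10 s20 in \<open>simp add: add_nonneg_nonneg\<close>)
  have "(\<integral>\<^sup>+x. \<psi> (\<sigma> x) \<partial>\<mu>) \<le> (\<integral>\<^sup>+x. \<psi> (\<sigma>1 x) / 2 + \<psi> (\<sigma>2 x) / 2 \<partial>\<mu>)"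
    using eq by (intro nn_integral_mono_AE, eventually_elim) (simp only: psi_midpoint)
  also have "\<dots> = (\<integral>\<^sup>+x. \<psi> (\<sigma>1 x) \<partial>\<mu>) / 2 + (\<integral>\<^sup>+x. \<psi> (\<sigma>2 x) \<partial>\<mu>) / 2"
    by (simp add: nn_integral_add nn_integral_divide)
  finally have "phi_divergence \<phi> \<nu> \<mu> \<le> (\<integral>\<^sup>+x. \<psi> (\<sigma>1 x) \<partial>\<mu>) / 2 + (\<integral>\<^sup>+x. \<psi> (\<sigma>2 x) \<partial>\<mu>) / 2
     + ?r * (emeasure \<nu>1 (space \<mu> - A) / 2 + emeasure \<nu>2 (space \<mu> - A) / 2)"
    unfolding D by (simp add: mid add_right_mono)
  also have "\<dots> = phi_divergence \<phi> \<nu>1 \<mu> / 2 + phi_divergence \<phi> \<nu>2 \<mu> / 2"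
    unfolding D1 D2 by (simp add: divide_ennreal_def algebra_simps)
  finally show ?thesis .
qed

text \<open>Test the inequality between the measures on the set where \<open>\<tau> \<le> \<sigma>\<close>.\<close>

lemma density_difference_L1:
  fixes \<sigma> \<tau> :: "'a \<Rightarrow> real"
  assumes [measurable]: "\<sigma> \<in> borel_measurable \<mu>" "\<tau> \<in> borel_measurable \<mu>"
    and nn: "\<And>x. 0 \<le> \<sigma> x" "\<And>x. 0 \<le> \<tau> x"
    and fin: "emeasure (density \<mu> (\<lambda>x. ennreal (\<tau> x))) (space \<mu>) < \<infinity>"
    and le: "\<And>B. B \<in> sets \<mu> \<Longrightarrow> emeasure (density \<mu> (\<lambda>x. ennreal (\<sigma> x))) B \<le> emeasure (density \<mu> (\<lambda>x. ennreal (\<tau> x))) B + d"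
  shows "(\<integral>\<^sup>+x. ennreal (\<sigma> x - \<tau> x) \<partial>\<mu>) \<le> d"
proof -
  define B where "B = {x \<in> space \<mu>. \<tau> x \<le> \<sigma> x}"
  have [measurable]: "B \<in> sets \<mu>" unfolding B_def by measurable
  let ?t = "emeasure (density \<mu> (\<lambda>x. ennreal (\<tau> x))) B"
  have "?t \<le> emeasure (density \<mu> (\<lambda>x. ennreal (\<tau> x))) (space \<mu>)"
    by (rule emeasure_mono) (auto simp: B_def)
  with fin have t: "?t < \<infinity>" by (rule le_less_trans[rotated])
  have "?t + (\<integral>\<^sup>+x. ennreal (\<sigma> x - \<tau> x) \<partial>\<mu>) = (\<integral>\<^sup>+x. ennreal (\<tau> x) * indicator B x + ennreal (\<sigma> x - \<tau> x) \<partial>\<mu>)"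
    by (simp add: emeasure_density nn_integral_add)
  also have "\<dots> = (\<integral>\<^sup>+x. ennreal (\<sigma> x) * indicator B x \<partial>\<mu>)"
  proof (intro nn_integral_cong)
    fix x assume x: "x \<in> space \<mu>"
    show "ennreal (\<tau> x) * indicator B x + ennreal (\<sigma> x - \<tau> x) = ennreal (\<sigma> x) * indicator B x"
    proof (cases "x \<in> B")
      case True
      then show ?thesis using nn(2)[of x] by (simp add: B_def flip: ennreal_plus)
    next
      case False
      then show ?thesis using x by (simp add: B_def ennreal_neg)
    qed
  qed
  also have "\<dots> = emeasure (density \<mu> (\<lambda>x. ennreal (\<sigma> x))) B" by (simp add: emeasure_density)
  also have "\<dots> \<le> ?t + d" by (rule le) simp
  finally show ?thesis using t by (auto simp: ennreal_add_left_cancel_le)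
qed

text \<open>With a common separating set, convergence in total variation gives \<open>L\<^sup>1\<close> convergence of the densities
  and convergence of the singular masses. The geometric rate makes the densities converge almost
  everywhere, and Fatou's lemma applies.\<close>

lemma (in nonneg_Gamma0) phi_divergence_lsc:
  assumes fin: "finite_measure \<mu>" "finite_measure \<nu>" "\<And>n::nat. finite_measure (\<nu>n n)"
    and sets: "sets \<nu> = sets \<mu>" "\<And>n. sets (\<nu>n n) = sets \<mu>"
    and A: "separating_set \<nu> \<mu> A" "\<And>n. separating_set (\<nu>n n) \<mu> A"
    and C: "0 \<le> C"
    and le: "\<And>n B. B \<in> sets \<mu> \<Longrightarrow> emeasure (\<nu>n n) B \<le> emeasure \<nu> B + ennreal (C / 2 ^ n)"
    and ge: "\<And>n B. B \<in> sets \<mu> \<Longrightarrow> emeasure \<nu> B \<le> emeasure (\<nu>n n) B + ennreal (C / 2 ^ n)"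
  shows "phi_divergence \<phi> \<nu> \<mu> \<le> liminf (\<lambda>n. phi_divergence \<phi> (\<nu>n n) \<mu>)"
proof -
  interpret \<mu>: finite_measure \<mu> by fact
  interpret \<nu>: finite_measure \<nu> by fact
  interpret \<nu>n: finite_measure "\<nu>n n" for n by fact
  let ?r = "e2ennreal (recession_constant \<phi>)"
  have [measurable]: "A \<in> sets \<mu>" using A by (simp add: separating_set_def)
  obtain \<sigma> where \<sigma>[measurable]: "\<sigma> \<in> borel_measurable \<mu>" and s0: "\<And>x. 0 \<le> \<sigma> x"
    and s: "\<And>B. B \<in> sets \<mu> \<Longrightarrow> emeasure (density \<mu> (\<lambda>x. ennreal (\<sigma> x))) B = emeasure \<nu> (B \<inter> A)"
    and D: "phi_divergence \<phi> \<nu> \<mu> = (\<integral>\<^sup>+x. \<psi> (\<sigma> x) \<partial>\<mu>) + ?r * emeasure \<nu> (space \<mu> - A)"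
    by (rule phi_divergence_separating_set[OF fin(2,1) sets(1) A(1)]) blast
  have "\<exists>\<tau>. \<tau> \<in> borel_measurable \<mu> \<and> (\<forall>x. 0 \<le> \<tau> x) \<and>
     (\<forall>B\<in>sets \<mu>. emeasure (density \<mu> (\<lambda>x. ennreal (\<tau> x))) B = emeasure (\<nu>n n) (B \<inter> A)) \<and>
     phi_divergence \<phi> (\<nu>n n) \<mu> = (\<integral>\<^sup>+x. \<psi> (\<tau> x) \<partial>\<mu>) + ?r * emeasure (\<nu>n n) (space \<mu> - A)" for n
    by (rule phi_divergence_separating_set[OF fin(3,1) sets(2) A(2)]) blast
  then obtain \<tau> where \<tau>[measurable]: "\<And>n. \<tau> n \<in> borel_measurable \<mu>" and t0: "\<And>n x. 0 \<le> \<tau> n x"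
    and t: "\<And>n B. B \<in> sets \<mu> \<Longrightarrow> emeasure (density \<mu> (\<lambda>x. ennreal (\<tau> n x))) B = emeasure (\<nu>n n) (B \<inter> A)"
    and Dn: "\<And>n. phi_divergence \<phi> (\<nu>n n) \<mu> = (\<integral>\<^sup>+x. \<psi> (\<tau> n x) \<partial>\<mu>) + ?r * emeasure (\<nu>n n) (space \<mu> - A)"
    by metis
  have L1: "(\<integral>\<^sup>+x. ennreal \<bar>\<tau> n x - \<sigma> x\<bar> \<partial>\<mu>) \<le> ennreal (2 * C / 2 ^ n)" for n
  proof -
    have "(\<integral>\<^sup>+x. ennreal \<bar>\<tau> n x - \<sigma> x\<bar> \<partial>\<mu>) = (\<integral>\<^sup>+x. ennreal (\<tau> n x - \<sigma> x) + ennreal (\<sigma> x - \<tau> n x) \<partial>\<mu>)"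
      by (intro nn_integral_cong) (auto simp: abs_real_def ennreal_neg)
    also have "\<dots> = (\<integral>\<^sup>+x. ennreal (\<tau> n x - \<sigma> x) \<partial>\<mu>) + (\<integral>\<^sup>+x. ennreal (\<sigma> x - \<tau> n x) \<partial>\<mu>)"
      by (rule nn_integral_add) auto
    also have "\<dots> \<le> ennreal (C / 2 ^ n) + ennreal (C / 2 ^ n)"
      by (intro add_mono density_difference_L1)
         (auto simp: s t s0 t0 le ge less_top[symmetric] \<nu>.emeasure_finite \<nu>n.emeasure_finite)
    also have "\<dots> = ennreal (2 * C / 2 ^ n)" using C by (simp flip: ennreal_plus)
    finally show ?thesis .
  qed
  have ae: "AE x in \<mu>. (\<lambda>n. \<tau> n x) \<longlonglongrightarrow> \<sigma> x"
    using L1 C by (intro AE_tendsto_of_L1_geometric[where C="2 * C"]) auto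
  have "(\<integral>\<^sup>+x. \<psi> (\<sigma> x) \<partial>\<mu>) \<le> (\<integral>\<^sup>+x. liminf (\<lambda>n. \<psi> (\<tau> n x)) \<partial>\<mu>)"
    using ae by (intro nn_integral_mono_AE, eventually_elim) (rule psi_lsc_sequentially)
  also have "\<dots> \<le> liminf (\<lambda>n. \<integral>\<^sup>+x. \<psi> (\<tau> n x) \<partial>\<mu>)"
    by (rule nn_integral_liminf) measurable
  finally have 1: "(\<integral>\<^sup>+x. \<psi> (\<sigma> x) \<partial>\<mu>) \<le> liminf (\<lambda>n. \<integral>\<^sup>+x. \<psi> (\<tau> n x) \<partial>\<mu>)" .
  have 2: "?r * emeasure \<nu> (space \<mu> - A) \<le> liminf (\<lambda>n. ?r * emeasure (\<nu>n n) (space \<mu> - A))"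
  proof -
    let ?E = "space \<mu> - A"
    have cl: "\<bar>measure (\<nu>n n) ?E - measure \<nu> ?E\<bar> \<le> C / 2 ^ n" for n
      using le[of ?E n] ge[of ?E n] C
      by (simp add: \<nu>.emeasure_eq_measure \<nu>n.emeasure_eq_measure abs_le_iff flip: ennreal_plus)
    have c0: "(\<lambda>n. C / 2 ^ n) \<longlonglongrightarrow> 0"
      using tendsto_mult_right_zero[OF LIMSEQ_power_zero[of "1/2::real"], of C] by (simp add: power_one_over)
    have "(\<lambda>n. measure (\<nu>n n) ?E - measure \<nu> ?E) \<longlonglongrightarrow> 0"
      by (rule Lim_null_comparison[OF _ c0]) (use cl in simp)
    then have "(\<lambda>n. emeasure (\<nu>n n) ?E) \<longlonglongrightarrow> emeasure \<nu> ?E"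
      by (simp add: \<nu>.emeasure_eq_measure \<nu>n.emeasure_eq_measure LIM_zero_iff tendsto_ennrealI)
    then have "?r * emeasure \<nu> ?E = ?r * liminf (\<lambda>n. emeasure (\<nu>n n) ?E)"
      by (simp add: lim_imp_Liminf)
    also have "\<dots> \<le> liminf (\<lambda>n. ?r * emeasure (\<nu>n n) ?E)"
      by (rule mult_liminf_le)
    finally show ?thesis .
  qed
  have "phi_divergence \<phi> \<nu> \<mu> \<le> liminf (\<lambda>n. \<integral>\<^sup>+x. \<psi> (\<tau> n x) \<partial>\<mu>) + liminf (\<lambda>n. ?r * emeasure (\<nu>n n) (space \<mu> - A))"
    unfolding D by (intro add_mono 1 2)
  also have "\<dots> \<le> liminf (\<lambda>n. phi_divergence \<phi> (\<nu>n n) \<mu>)"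
    unfolding Dn by (rule liminf_superadditive)
  finally show ?thesis .
qed

section \<open>Divergences of push-forwards\<close>

lemma finite_measure_density:
  assumes "f \<in> densities G"
  shows "finite_measure (density G (\<lambda>x. ennreal (f x)))"
  using nn_integral_densities_finite[OF assms] densitiesD(2)[OF assms]
  by (intro finite_measureI) (simp add: emeasure_density cong: nn_integral_cong)

lemma emeasure_density_le_L1:
  fixes f g :: "'a \<Rightarrow> real"
  assumes [measurable]: "f \<in> borel_measurable G" "g \<in> borel_measurable G" "E \<in> sets G" and "\<And>x. 0 \<le> g x"
  shows "emeasure (density G (\<lambda>x. ennreal (f x))) E \<le>
    emeasure (density G (\<lambda>x. ennreal (g x))) E + (\<integral>\<^sup>+x. ennreal \<bar>f x - g x\<bar> \<partial>G)"
proof -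
  have "emeasure (density G (\<lambda>x. ennreal (f x))) E = (\<integral>\<^sup>+x. ennreal (f x) * indicator E x \<partial>G)"
    by (simp add: emeasure_density)
  also have "\<dots> \<le> (\<integral>\<^sup>+x. ennreal (g x) * indicator E x + ennreal \<bar>f x - g x\<bar> \<partial>G)"
  proof (rule nn_integral_mono)
    fix x
    have "ennreal (f x) \<le> ennreal (g x + \<bar>f x - g x\<bar>)" by (rule ennreal_leI) simp
    also have "\<dots> = ennreal (g x) + ennreal \<bar>f x - g x\<bar>" using assms(4) by simp
    finally show "ennreal (f x) * indicator E x \<le> ennreal (g x) * indicator E x + ennreal \<bar>f x - g x\<bar>"
      by (simp split: split_indicator)
  qed
  also have "\<dots> = emeasure (density G (\<lambda>x. ennreal (g x))) E + (\<integral>\<^sup>+x. ennreal \<bar>f x - g x\<bar> \<partial>G)"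
    by (simp add: nn_integral_add emeasure_density)
  finally show ?thesis .
qed

text \<open>The divergence of the image under \<open>T\<close> of a measure with density \<open>f\<close> with respect to \<open>G\<close>, as a function
  of \<open>f\<close>. The coordinate projections of a product are the maps \<open>T\<close> of interest.\<close>

locale pushforward_divergence = nonneg_Gamma0 \<phi> + G: finite_measure G + \<mu>: finite_measure \<mu>
  for \<phi> :: "real \<Rightarrow> ereal" and G :: "'a measure" and \<mu> :: "'b measure" +
  fixes Y :: "'b measure" and T :: "'a \<Rightarrow> 'b"
  assumes sets_Y: "sets Y = sets \<mu>" and T[measurable]: "T \<in> measurable G Y"
begin

definition push :: "('a \<Rightarrow> real) \<Rightarrow> 'b measure" where
  "push f = distr (density G (\<lambda>x. ennreal (f x))) Y T"

lemma sets_push: "sets (push f) = sets \<mu>" by (simp add: push_def sets_Y)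

lemma emeasure_push:
  assumes "B \<in> sets \<mu>"
  shows "emeasure (push f) B = emeasure (density G (\<lambda>x. ennreal (f x))) (T -` B \<inter> space G)"
  using assms sets_Y unfolding push_def by (subst emeasure_distr) auto

lemma finite_push: "f \<in> densities G \<Longrightarrow> finite_measure (push f)"
  unfolding push_def by (intro finite_measure.finite_measure_distr finite_measure_density) auto

text \<open>All these images are dominated by the image of \<open>G\<close> itself.\<close>

lemma common_separating_set:
  obtains A where "\<And>f. f \<in> densities G \<Longrightarrow> separating_set (push f) \<mu> A"
proof -
  have "finite_measure (distr G Y T)" by (rule G.finite_measure_distr) measurable
  then obtain A where A: "separating_set (distr G Y T) \<mu> A"
    using separating_set_exists[of "distr G Y T" \<mu>] sets_Y by auto
  have "separating_set (push f) \<mu> A" if "f \<in> densities G" for f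
  proof (rule separating_set_absolutely_continuous[OF A])
    note [measurable] = densitiesD(2)[OF that]
    have ac: "absolutely_continuous G (density G (\<lambda>x. ennreal (f x)))"
      by (rule absolutely_continuousI_density) measurable
    show "absolutely_continuous (distr G Y T) (push f)"
      unfolding absolutely_continuous_def
    proof
      fix B assume "B \<in> null_sets (distr G Y T)"
      then have B: "B \<in> sets Y" "T -` B \<inter> space G \<in> null_sets G"
        by (auto simp: null_sets_def emeasure_distr)
      then have "T -` B \<inter> space G \<in> null_sets (density G (\<lambda>x. ennreal (f x)))"
        using ac by (auto simp: absolutely_continuous_def)
      then show "B \<in> null_sets (push f)"
        using B(1) sets_Y emeasure_push[of B f] by (auto simp: null_sets_def sets_push)
    qed
  qed (simp add: sets_Y)
  then show ?thesis by (rule that)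
qed

lemma push_midpoint:
  assumes f: "f \<in> densities G" and g: "g \<in> densities G"
  shows "phi_divergence \<phi> (push (\<lambda>x. (f x + g x) / 2)) \<mu>
    \<le> phi_divergence \<phi> (push f) \<mu> / 2 + phi_divergence \<phi> (push g) \<mu> / 2"
proof -
  note [measurable] = densitiesD(2)[OF f] densitiesD(2)[OF g]
  obtain A where A: "\<And>f. f \<in> densities G \<Longrightarrow> separating_set (push f) \<mu> A"
    using common_separating_set by blast
  have m: "(\<lambda>x. (f x + g x) / 2) \<in> densities G" by (rule midpoint_in_densities[OF f g])
  show ?thesis
  proof (rule phi_divergence_midpoint[OF \<mu>.finite_measure_axioms finite_push[OF m] finite_push[OF f] finite_push[OF g]
         sets_push sets_push sets_push A[OF m] A[OF f] A[OF g]])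
    fix B assume B: "B \<in> sets \<mu>"
    have [measurable]: "T -` B \<inter> space G \<in> sets G" using B sets_Y by (intro measurable_sets[OF T]) simp
    let ?E = "T -` B \<inter> space G"
    have "emeasure (push (\<lambda>x. (f x + g x) / 2)) B =
      (\<integral>\<^sup>+x. ennreal (f x) * indicator ?E x / 2 + ennreal (g x) * indicator ?E x / 2 \<partial>G)"
      using densitiesD(3)[OF f] densitiesD(3)[OF g]
      by (subst emeasure_push[OF B], subst emeasure_density)
         (auto simp: ennreal_midpoint intro!: nn_integral_cong split: split_indicator)
    also have "\<dots> = emeasure (push f) B / 2 + emeasure (push g) B / 2"
      by (simp add: emeasure_push[OF B] emeasure_density nn_integral_add nn_integral_divide)
    finally show "emeasure (push (\<lambda>x. (f x + g x) / 2)) B = emeasure (push f) B / 2 + emeasure (push g) B / 2" .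
  qed
qed

lemma push_lsc:
  assumes f: "\<And>n. f n \<in> densities G" and g: "g \<in> densities G" and C: "0 \<le> C"
    and L1: "\<And>n. (\<integral>\<^sup>+x. ennreal \<bar>f n x - g x\<bar> \<partial>G) \<le> ennreal (C / 2 ^ n)"
  shows "phi_divergence \<phi> (push g) \<mu> \<le> liminf (\<lambda>n. phi_divergence \<phi> (push (f n)) \<mu>)"
proof -
  note [measurable] = densitiesD(2)[OF f] densitiesD(2)[OF g]
  obtain A where A: "\<And>f. f \<in> densities G \<Longrightarrow> separating_set (push f) \<mu> A"
    using common_separating_set by blast
  show ?thesis
  proof (rule phi_divergence_lsc[OF \<mu>.finite_measure_axioms finite_push[OF g] finite_push[OF f]
         sets_push sets_push A[OF g] A[OF f] C])
    fix n B assume B: "B \<in> sets \<mu>"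
    have [measurable]: "T -` B \<inter> space G \<in> sets G" using B sets_Y by (intro measurable_sets[OF T]) simp
    show "emeasure (push (f n)) B \<le> emeasure (push g) B + ennreal (C / 2 ^ n)"
      unfolding emeasure_push[OF B]
      by (rule order_trans[OF emeasure_density_le_L1 add_left_mono[OF L1]]) (auto simp: densitiesD(3)[OF g])
    have L1': "(\<integral>\<^sup>+x. ennreal \<bar>g x - f n x\<bar> \<partial>G) \<le> ennreal (C / 2 ^ n)"
      using L1[of n] by (subst abs_minus_commute)
    show "emeasure (push g) B \<le> emeasure (push (f n)) B + ennreal (C / 2 ^ n)"
      unfolding emeasure_push[OF B]
      by (rule order_trans[OF emeasure_density_le_L1 add_left_mono[OF L1']]) (auto simp: densitiesD(3)[OF f])
  qed
qed

end

section \<open>Borel sets of finite products\<close>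

text \<open>Balls of radius \<open>1 / (n + 1)\<close> around the points of a countable dense set form a base.\<close>

lemma second_countable_separable_metrizable:
  assumes "metrizable_space X" "separable_space X"
  shows "second_countable X"
proof -
  obtain M d where "Metric_space M d" and X: "X = Metric_space.mtopology M d"
    using assms(1) by (auto simp: metrizable_space_def)
  interpret Metric_space M d by fact
  obtain D where D: "countable D" "D \<subseteq> M" "X closure_of D = M"
    using assms(2) by (auto simp: separable_space_def X)
  let ?B = "(\<lambda>(a, n). mball a (1 / real (Suc n))) ` (D \<times> UNIV)"
  have "\<exists>V\<in>?B. x \<in> V \<and> V \<subseteq> U" if U: "openin X U" "x \<in> U" for U x
  proof -
    obtain r where r: "0 < r" "mball x r \<subseteq> U" and x: "x \<in> M"
      using U unfolding X openin_mtopology by blast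
    obtain n where n: "1 / real (Suc n) < r / 2"
      using r by (metis half_gt_zero inverse_eq_divide reals_Archimedean)
    have "x \<in> X closure_of D" using D x by simp
    moreover have "0 < 1 / real (Suc n)" by simp
    ultimately obtain a where a: "a \<in> D" "a \<in> mball x (1 / real (Suc n))"
      unfolding X metric_closure_of by blast
    have "mball a (1 / real (Suc n)) \<subseteq> mball x r"
    proof
      fix y assume y: "y \<in> mball a (1 / real (Suc n))"
      then have "d x y \<le> d x a + d a y" using a x by (intro triangle) auto
      then show "y \<in> mball x r" using a y n by auto
    qed
    then show ?thesis using a r x by (intro bexI[of _ "mball a (1 / real (Suc n))"]) (auto simp: commute)
  qed
  moreover have "countable ?B" using D by auto
  moreover have "\<forall>V\<in>?B. openin X V" by (auto simp: X)
  ultimately show ?thesis unfolding second_countable_def by blast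
qed

lemma space_borel_of[simp]: "space (borel_of X) = topspace X"
  by (simp add: borel_of_def space_measure_of_conv)

lemma sets_borel_of: "sets (borel_of X) = sigma_sets (topspace X) {U. openin X U}"
  unfolding borel_of_def by (rule sets_measure_of) (auto dest: openin_subset)

lemma openin_in_borel_of: "openin X U \<Longrightarrow> U \<in> sets (borel_of X)"
  by (simp add: sets_borel_of)

lemma measurable_borel_of:
  assumes "f \<in> space M \<rightarrow> topspace X" "\<And>U. openin X U \<Longrightarrow> f -` U \<inter> space M \<in> sets M"
  shows "f \<in> measurable M (borel_of X)"
  unfolding borel_of_def by (rule measurable_measure_of) (use assms in \<open>auto dest: openin_subset\<close>)

lemma continuous_map_borel_measurable:
  assumes "continuous_map X Y f"
  shows "f \<in> measurable (borel_of X) (borel_of Y)"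
proof (rule measurable_borel_of)
  fix U assume "openin Y U"
  then have "openin X {x \<in> topspace X. f x \<in> U}" using assms by (rule openin_continuous_map_preimage[rotated])
  also have "{x \<in> topspace X. f x \<in> U} = f -` U \<inter> space (borel_of X)" by auto
  finally show "f -` U \<inter> space (borel_of X) \<in> sets (borel_of X)" by (rule openin_in_borel_of)
qed (use assms in \<open>auto simp: continuous_map_def\<close>)

lemma borel_of_euclidean: "sets (borel_of euclidean) = sets borel"
  by (simp add: sets_borel_of borel_def)

text \<open>Projections are continuous, which gives one inclusion. For the other, an open set is the union of the
  boxes it contains whose sides are taken from countable bases of the factors, and there are only
  countably many such boxes.\<close>

lemma sets_PiM_borel_of:
  assumes I: "finite I" and sc: "\<And>i. i \<in> I \<Longrightarrow> second_countable (X i)"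
  shows "sets (PiM I (\<lambda>i. borel_of (X i))) = sets (borel_of (product_topology X I))"
proof
  let ?P = "PiM I (\<lambda>i. borel_of (X i))" and ?T = "product_topology X I"
  show "sets ?P \<subseteq> sets (borel_of ?T)"
  proof (rule sets_PiM_in_sets)
    show "space (borel_of ?T) = (\<Pi>\<^sub>E i\<in>I. space (borel_of (X i)))"
      by (simp add: topspace_product_topology)
  next
    fix i E assume i: "i \<in> I" "E \<in> sets (borel_of (X i))"
    have "(\<lambda>x. x i) \<in> measurable (borel_of ?T) (borel_of (X i))"
      using i by (intro continuous_map_borel_measurable continuous_map_product_projection)
    from measurable_sets[OF this i(2)]
    show "{f \<in> space (borel_of ?T). f i \<in> E} \<in> sets (borel_of ?T)"
      by (simp add: vimage_def Int_def conj_commute)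
  qed
  have open_in: "U \<in> sets ?P" if U: "openin ?T U" for U
  proof -
    have "\<exists>B. countable B \<and> (\<forall>V\<in>B. openin (X i) V) \<and>
       (\<forall>U x. openin (X i) U \<and> x \<in> U \<longrightarrow> (\<exists>V\<in>B. x \<in> V \<and> V \<subseteq> U))" if "i \<in> I" for i
      using sc[OF that] by (simp add: second_countable_def)
    then obtain B where B: "\<And>i. i \<in> I \<Longrightarrow> countable (B i)" "\<And>i V. i \<in> I \<Longrightarrow> V \<in> B i \<Longrightarrow> openin (X i) V"
      "\<And>i U x. i \<in> I \<Longrightarrow> openin (X i) U \<Longrightarrow> x \<in> U \<Longrightarrow> \<exists>V\<in>B i. x \<in> V \<and> V \<subseteq> U"
      by metis
    define F where "F = {PiE I V | V. V \<in> PiE I B \<and> PiE I V \<subseteq> U}"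
    have "F \<subseteq> PiE I ` (PiE I B)" by (auto simp: F_def)
    moreover have "countable (PiE I ` (PiE I B))" using I B(1) by (intro countable_image countable_PiE)
    ultimately have cF: "countable F" by (rule countable_subset)
    have "U = \<Union>F"
    proof
      show "U \<subseteq> \<Union>F"
      proof
        fix x assume x: "x \<in> U"
        have "\<exists>W. finite {i \<in> I. W i \<noteq> topspace (X i)} \<and> (\<forall>i\<in>I. openin (X i) (W i)) \<and> x \<in> PiE I W \<and> PiE I W \<subseteq> U"
          by (rule bspec[OF iffD1[OF openin_product_topology_alt U] x])
        then obtain W where W: "\<And>i. i \<in> I \<Longrightarrow> openin (X i) (W i)" "x \<in> PiE I W" "PiE I W \<subseteq> U"
        proof (elim exE conjE)
          fix W assume "\<forall>i\<in>I. openin (X i) (W i)" "x \<in> PiE I W" "PiE I W \<subseteq> U"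
          then show thesis by (intro that[of W]) (rule bspec)
        qed
        have "\<exists>V\<in>B i. x i \<in> V \<and> V \<subseteq> W i" if "i \<in> I" for i
          using B(3)[OF that W(1)[OF that]] W(2) that by auto
        then obtain V where V: "\<And>i. i \<in> I \<Longrightarrow> V i \<in> B i \<and> x i \<in> V i \<and> V i \<subseteq> W i" by metis
        have "x \<in> PiE I (restrict V I)" using V W(2) by (auto simp: PiE_iff)
        moreover have "PiE I (restrict V I) \<subseteq> PiE I W" using V by (intro PiE_mono) auto
        ultimately show "x \<in> \<Union>F" using V W(3) unfolding F_def
          by (intro UnionI[of "PiE I (restrict V I)"]) (auto intro!: exI[of _ "restrict V I"])
      qed
    qed (auto simp: F_def)
    moreover have "F \<subseteq> sets ?P"
      using I B(2) by (auto simp: F_def intro!: sets_PiM_I_finite openin_in_borel_of)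
    ultimately show ?thesis using cF by (metis sets.countable_Union)
  qed
  have "sigma_sets (space ?P) {U. openin ?T U} \<subseteq> sets ?P"
    by (rule sets.sigma_sets_subset) (use open_in in auto)
  then show "sets (borel_of ?T) \<subseteq> sets ?P"
    by (simp add: sets_borel_of space_PiM topspace_product_topology)
qed

text \<open>The factors outside \<open>I\<close> are arbitrary. As the product measure depends only on the factors in \<open>I\<close>,
  the others may be replaced by the measure on the empty space, so that all factors are finite.\<close>

lemma finite_measure_PiM:
  assumes "finite I" "\<And>i. i \<in> I \<Longrightarrow> finite_measure (M i)"
  shows "finite_measure (PiM I M)"
proof -
  define M' where "M' i = (if i \<in> I then M i else count_space {})" for i
  have fin: "finite_measure (M' i)" for i
    using assms(2) by (auto simp: M'_def intro!: finite_measure_count_space)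
  interpret product_sigma_finite M'
    unfolding product_sigma_finite_def using fin by (auto simp: finite_measure_def)
  have "emeasure (PiM I M') (space (PiM I M')) = (\<Prod>i\<in>I. emeasure (M' i) (space (M' i)))"
    unfolding space_PiM using assms(1) by (intro emeasure_PiM) auto
  also have "\<dots> \<noteq> \<infinity>"
    using fin by (auto simp: ennreal_prod_eq_top finite_measure.emeasure_finite)
  finally have "finite_measure (PiM I M')" by (rule finite_measureI)
  also have "PiM I M' = PiM I M" by (rule PiM_cong) (auto simp: M'_def)
  finally show ?thesis .
qed

lemma compact_polish_second_countable: "compact_polish_space X \<Longrightarrow> second_countable X"
  by (simp add: compact_polish_space_def completely_metrizable_imp_metrizable_space second_countable_separable_metrizable)

lemma sets_prod_meas:
  assumes "\<And>i. i \<in> {1..N} \<Longrightarrow> second_countable (X i)"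
    and "\<And>i. i \<in> {1..N} \<Longrightarrow> \<gamma> i \<in> finite_borel_measures (X i)"
  shows "sets (prod_meas N \<gamma>) = sets (borel_of (prod_space N X))"
proof -
  have "sets (prod_meas N \<gamma>) = sets (PiM {1..N} (\<lambda>i. borel_of (X i)))"
    using assms(2) by (intro sets_PiM_cong) (auto simp: finite_borel_measures_def)
  then show ?thesis using sets_PiM_borel_of[of "{1..N}" X] assms(1) by simp
qed

section \<open>The transport problem\<close>

lemma linear_cost_midpoint:
  assumes c[measurable]: "c \<in> borel_measurable G" and f: "f \<in> densities G" and g: "g \<in> densities G"
  shows "(\<integral>\<^sup>+x. ennreal (c x) * ennreal ((f x + g x) / 2) \<partial>G) =
     (\<integral>\<^sup>+x. ennreal (c x) * ennreal (f x) \<partial>G) / 2 + (\<integral>\<^sup>+x. ennreal (c x) * ennreal (g x) \<partial>G) / 2"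
proof -
  note [measurable] = densitiesD(2)[OF f] densitiesD(2)[OF g]
  have "(\<integral>\<^sup>+x. ennreal (c x) * ennreal ((f x + g x) / 2) \<partial>G) =
     (\<integral>\<^sup>+x. ennreal (c x) * ennreal (f x) / 2 + ennreal (c x) * ennreal (g x) / 2 \<partial>G)"
    by (intro nn_integral_cong)
       (simp only: ennreal_midpoint densitiesD(3)[OF f] densitiesD(3)[OF g] distrib_left ennreal_times_divide)
  also have "\<dots> = (\<integral>\<^sup>+x. ennreal (c x) * ennreal (f x) \<partial>G) / 2 + (\<integral>\<^sup>+x. ennreal (c x) * ennreal (g x) \<partial>G) / 2"
    by (simp add: nn_integral_add nn_integral_divide)
  finally show ?thesis .
qed

lemma linear_cost_lsc:
  assumes c[measurable]: "c \<in> borel_measurable G" and f: "\<And>n::nat. f n \<in> densities G" and g: "g \<in> densities G"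
    and lim: "AE x in G. (\<lambda>n. f n x) \<longlonglongrightarrow> g x"
  shows "(\<integral>\<^sup>+x. ennreal (c x) * ennreal (g x) \<partial>G) \<le> liminf (\<lambda>n. \<integral>\<^sup>+x. ennreal (c x) * ennreal (f n x) \<partial>G)"
proof -
  note [measurable] = densitiesD(2)[OF f] densitiesD(2)[OF g]
  have "(\<integral>\<^sup>+x. ennreal (c x) * ennreal (g x) \<partial>G) = (\<integral>\<^sup>+x. liminf (\<lambda>n. ennreal (c x) * ennreal (f n x)) \<partial>G)"
    using lim
    by (intro nn_integral_cong_AE, eventually_elim)
       (auto intro!: lim_imp_Liminf[symmetric] tendsto_intros ennreal_tendsto_cmult)
  also have "\<dots> \<le> liminf (\<lambda>n. \<integral>\<^sup>+x. ennreal (c x) * ennreal (f n x) \<partial>G)"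
    by (rule nn_integral_liminf) measurable
  finally show ?thesis .
qed

theorem proposition3p3:
  fixes \<epsilon> :: real and N :: nat
    and X :: "nat \<Rightarrow> 'a topology"
    and \<mu> \<gamma> :: "nat \<Rightarrow> 'a measure"
    and \<phi> :: "nat \<Rightarrow> real \<Rightarrow> ereal"
    and c :: "(nat \<Rightarrow> 'a) \<Rightarrow> real"
  assumes "\<epsilon> > 0" and "N \<ge> 1"
    and "\<And>i. i \<in> {1..N} \<Longrightarrow> topspace (X i) \<noteq> {}"
    and "\<And>i. i \<in> {1..N} \<Longrightarrow> compact_polish_space (X i)"
    and "\<And>i. i \<in> {1..N} \<Longrightarrow> \<mu> i \<in> finite_borel_measures (X i)"
    and "\<And>i. i \<in> {1..N} \<Longrightarrow> fully_supported (X i) (\<mu> i)"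
    and "\<And>i. i \<in> {1..N} \<Longrightarrow> \<gamma> i \<in> finite_borel_measures (X i)"
    and "KL (prod_meas N \<mu>) (prod_meas N \<gamma>) < \<infinity>"
    and "\<And>i. i \<in> {1..N} \<Longrightarrow> entropy_function (\<phi> i)"
    and "continuous_map (prod_space N X) euclideanreal c"
    and "\<And>x. x \<in> topspace (prod_space N X) \<Longrightarrow> 0 \<le> c x"
    and feasible: "UMOT \<epsilon> N X c \<gamma> \<phi> \<mu> < \<infinity>"
  shows "\<exists>!\<pi>. optimal_plan \<epsilon> N X c \<gamma> \<phi> \<mu> \<pi>"
proof -
  define G where "G = prod_meas N \<gamma>"
  define F where "F = UMOT_functional \<epsilon> N X c \<gamma> \<phi> \<mu>"
  define plans where "plans = finite_borel_measures (prod_space N X)"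
  interpret G: finite_measure G
    unfolding G_def using assms(7) by (intro finite_measure_PiM) (auto simp: finite_borel_measures_def)
  have sets_G: "sets G = sets (borel_of (prod_space N X))"
    unfolding G_def using assms(4,7) by (intro sets_prod_meas compact_polish_second_countable)
  have space_G: "space G = topspace (prod_space N X)"
    using sets_eq_imp_space_eq[OF sets_G] by simp
  have c_meas[measurable]: "c \<in> borel_measurable G"
  proof -
    have "c \<in> measurable (borel_of (prod_space N X)) (borel_of euclideanreal)"
      by (rule continuous_map_borel_measurable) fact
    then show ?thesis using measurable_cong_sets[OF sets_G borel_of_euclidean[symmetric]] by blast
  qed
  obtain K where K: "\<And>x. x \<in> space G \<Longrightarrow> \<bar>c x\<bar> \<le> K"
  proof -
    have "compact_space (prod_space N X)"
      using assms(4) by (auto simp: compact_space_product_topology compact_polish_space_def)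
    then have "compactin euclideanreal (c ` topspace (prod_space N X))"
      using assms(10) by (intro image_compactin) (auto simp: compact_space_def)
    then have "bounded (c ` space G)" by (simp add: space_G compact_imp_bounded)
    then show thesis using that unfolding bounded_iff by auto
  qed

  \<comment> \<open>everything in the functional except the entropy, as a function of the density of the plan\<close>
  define J where "J f = (\<integral>\<^sup>+x. ennreal (c x) * ennreal (f x) \<partial>G) +
    (\<Sum>i = 1..N. phi_divergence (\<phi> i) (marginal X (density G (\<lambda>x. ennreal (f x))) i) (\<mu> i))" for f
  have pd: "pushforward_divergence (\<phi> i) G (\<mu> i) (borel_of (X i)) (\<lambda>x. x i)" if "i \<in> {1..N}" for i
  proof -
    have "(\<lambda>x. x i) \<in> measurable (borel_of (prod_space N X)) (borel_of (X i))"
      using that by (intro continuous_map_borel_measurable continuous_map_product_projection)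
    then have "(\<lambda>x. x i) \<in> measurable G (borel_of (X i))"
      using measurable_cong_sets[OF sets_G refl] by blast
    moreover have "finite_measure (\<mu> i)" "sets (borel_of (X i)) = sets (\<mu> i)"
      using assms(5)[OF that] by (auto simp: finite_borel_measures_def)
    ultimately show ?thesis
      using assms(9)[OF that] G.finite_measure_axioms
      by (auto simp: pushforward_divergence_def pushforward_divergence_axioms_def nonneg_Gamma0_def entropy_function_def)
  qed
  have push: "pushforward_divergence.push G (borel_of (X i)) (\<lambda>x. x i) f =
      marginal X (density G (\<lambda>x. ennreal (f x))) i" if "i \<in> {1..N}" for i f
    by (simp add: pushforward_divergence.push_def[OF pd[OF that]] marginal_def)
  interpret entropic_functional G J \<epsilon>
  proof
    fix f g assume f: "f \<in> densities G" and g: "g \<in> densities G"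
    let ?D = "\<lambda>f i. phi_divergence (\<phi> i) (marginal X (density G (\<lambda>x. ennreal (f x))) i) (\<mu> i)"
    have "(\<Sum>i = 1..N. ?D (\<lambda>x. (f x + g x) / 2) i) \<le> (\<Sum>i = 1..N. ?D f i / 2 + ?D g i / 2)"
      using pushforward_divergence.push_midpoint[OF pd f g] by (intro sum_mono) (simp add: push)
    also have "\<dots> = (\<Sum>i = 1..N. ?D f i) / 2 + (\<Sum>i = 1..N. ?D g i) / 2"
      by (simp add: sum.distrib divide_ennreal_def sum_distrib_right)
    finally show "J (\<lambda>x. (f x + g x) / 2) \<le> J f / 2 + J g / 2"
      unfolding J_def linear_cost_midpoint[OF c_meas f g]
      by (simp add: divide_ennreal_def distrib_right add.assoc add.left_commute add_left_mono)
  next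
    fix f g C assume f: "\<And>n. f n \<in> densities G" and g: "g \<in> densities G"
      and lim: "AE x in G. (\<lambda>n. f n x) \<longlonglongrightarrow> g x" and C: "0 \<le> C"
      and L1: "\<And>n. (\<integral>\<^sup>+x. ennreal \<bar>f n x - g x\<bar> \<partial>G) \<le> ennreal (C / 2 ^ n)"
    let ?D = "\<lambda>f i. phi_divergence (\<phi> i) (marginal X (density G (\<lambda>x. ennreal (f x))) i) (\<mu> i)"
    let ?c = "\<lambda>f. \<integral>\<^sup>+x. ennreal (c x) * ennreal (f x) \<partial>G"
    have "(\<Sum>i = 1..N. ?D g i) \<le> (\<Sum>i = 1..N. liminf (\<lambda>n. ?D (f n) i))"
      using pushforward_divergence.push_lsc[OF pd f g C L1] by (intro sum_mono) (simp add: push)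
    also have "\<dots> \<le> liminf (\<lambda>n. \<Sum>i = 1..N. ?D (f n) i)"
      by (rule liminf_superadditive_sum) simp
    finally have "J g \<le> liminf (\<lambda>n. ?c (f n)) + liminf (\<lambda>n. \<Sum>i = 1..N. ?D (f n) i)"
      unfolding J_def by (intro add_mono linear_cost_lsc[OF c_meas f g lim])
    also have "\<dots> \<le> liminf (\<lambda>n. J (f n))"
      unfolding J_def by (rule liminf_superadditive)
    finally show "J g \<le> liminf (\<lambda>n. J (f n))" .
  qed fact

  have dens_plan: "density G (\<lambda>x. ennreal (f x)) \<in> plans" if "f \<in> densities G" for f
    using finite_measure_density[OF that] sets_G by (simp add: plans_def finite_borel_measures_def)
  \<comment> \<open>Plans with a density are the only ones of finite cost, and on them the functional is the energy.\<close>
  have F_dens: "F (density G (\<lambda>x. ennreal (f x))) = enn2ereal (energy f)" if f: "f \<in> densities G" for f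
  proof -
    note [measurable] = densitiesD(2)[OF f]
    let ?\<pi> = "density G (\<lambda>x. ennreal (f x))"
    interpret \<pi>: finite_measure ?\<pi> by (rule finite_measure_density[OF f])
    have "integrable ?\<pi> c"
      by (rule \<pi>.integrable_const_bound[of _ K]) (auto intro!: AE_I2 K)
    moreover have "AE x in ?\<pi>. 0 \<le> c x" using assms(11) by (intro AE_I2) (simp add: space_G)
    ultimately have "(\<integral>\<^sup>+x. ennreal (c x) \<partial>?\<pi>) = ennreal (\<integral>x. c x \<partial>?\<pi>)" "0 \<le> (\<integral>x. c x \<partial>?\<pi>)"
      by (auto intro: nn_integral_eq_integral integral_nonneg_AE)
    moreover have "(\<integral>\<^sup>+x. ennreal (c x) \<partial>?\<pi>) = (\<integral>\<^sup>+x. ennreal (c x) * ennreal (f x) \<partial>G)"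
      by (subst nn_integral_density) (auto simp: mult.commute)
    ultimately have cost: "ereal (\<integral>x. c x \<partial>?\<pi>) = enn2ereal (\<integral>\<^sup>+x. ennreal (c x) * ennreal (f x) \<partial>G)"
      by (metis enn2ereal_ennreal)
    have ent: "ereal \<epsilon> * KL ?\<pi> G = enn2ereal (ennreal \<epsilon> * relative_entropy G f)"
      using \<open>\<epsilon> > 0\<close> by (simp add: KL_density[OF G.finite_measure_axioms f] times_ennreal.rep_eq)
    show ?thesis
      unfolding F_def UMOT_functional_def G_def[symmetric] cost ent energy_def J_def
      by (simp add: plus_ennreal.rep_eq add.assoc add.commute add.left_commute)
  qed
  have plan_dens: "\<exists>f\<in>densities G. \<pi> = density G (\<lambda>x. ennreal (f x))" if "\<pi> \<in> plans" "F \<pi> < \<infinity>" for \<pi>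
  proof -
    have "KL \<pi> G \<noteq> \<infinity>"
    proof
      assume "KL \<pi> G = \<infinity>"
      then have "F \<pi> = \<infinity>" using \<open>\<epsilon> > 0\<close>
        unfolding F_def UMOT_functional_def G_def[symmetric] by simp
      with that(2) show False by simp
    qed
    moreover have "finite_measure \<pi>" "sets \<pi> = sets G"
      using that(1) sets_G by (auto simp: plans_def finite_borel_measures_def)
    ultimately show ?thesis
      using KL_finite_imp_density[OF G.finite_measure_axioms] by metis
  qed
  have UMOT: "UMOT \<epsilon> N X c \<gamma> \<phi> \<mu> = (INF \<pi>\<in>plans. F \<pi>)"
    by (simp add: UMOT_def F_def plans_def)
  have opt: "optimal_plan \<epsilon> N X c \<gamma> \<phi> \<mu> \<pi> \<longleftrightarrow> \<pi> \<in> plans \<and> F \<pi> = (INF \<pi>\<in>plans. F \<pi>)" for \<pi>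
    unfolding optimal_plan_def UMOT F_def plans_def ..
  obtain \<pi>0 where "\<pi>0 \<in> plans" "F \<pi>0 < \<infinity>"
    using feasible unfolding UMOT INF_less_iff by blast
  then obtain f0 where f0: "f0 \<in> densities G" and "F (density G (\<lambda>x. ennreal (f0 x))) < \<infinity>"
    using plan_dens by blast
  then have "energy f0 < \<infinity>" by (simp add: F_dens less_top)
  obtain f where f: "f \<in> densities G" and min: "\<And>g. g \<in> densities G \<Longrightarrow> energy f \<le> energy g"
    and uniq: "\<And>g. g \<in> densities G \<Longrightarrow> energy g \<le> energy f \<Longrightarrow> AE x in G. g x = f x"
    using unique_minimiser[OF f0 \<open>energy f0 < \<infinity>\<close>] by metis
  let ?\<pi> = "density G (\<lambda>x. ennreal (f x))"
  have F_min: "F ?\<pi> \<le> F \<pi>" if "\<pi> \<in> plans" for \<pi>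
  proof (cases "F \<pi> < \<infinity>")
    case True
    with plan_dens[OF that] obtain g where g: "g \<in> densities G" "\<pi> = density G (\<lambda>x. ennreal (g x))" by auto
    then show ?thesis using min[OF g(1)] by (simp add: F_dens f less_eq_ennreal.rep_eq)
  qed auto
  have val: "(INF \<pi>\<in>plans. F \<pi>) = F ?\<pi>"
    using F_min dens_plan[OF f] by (intro antisym INF_lower INF_greatest)
  show ?thesis
  proof (rule ex1I[of _ ?\<pi>])
    show "optimal_plan \<epsilon> N X c \<gamma> \<phi> \<mu> ?\<pi>" using dens_plan[OF f] by (simp add: opt val)
  next
    fix \<pi> assume "optimal_plan \<epsilon> N X c \<gamma> \<phi> \<mu> \<pi>"
    then have \<pi>: "\<pi> \<in> plans" "F \<pi> = F ?\<pi>" by (auto simp: opt val)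
    moreover have "F \<pi> < \<infinity>" using feasible unfolding UMOT val \<pi>(2) .
    ultimately obtain g where g: "g \<in> densities G" "\<pi> = density G (\<lambda>x. ennreal (g x))"
      using plan_dens by blast
    then have "energy g \<le> energy f" using \<pi>(2) by (simp add: F_dens f enn2ereal_inject)
    then have "AE x in G. g x = f x" by (rule uniq[OF g(1)])
    then show "\<pi> = ?\<pi>"
      unfolding g(2) using densitiesD(2)[OF f] densitiesD(2)[OF g(1)] by (intro density_cong) auto
  qed
qed

end
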